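(* Let $1<q\le 2$, $0<\sigma\le 1$, $0<\nu\le 1$, let $n\ge 1$ be an integer, let $0<\xi<\eta_1<\eta_2<\dots<\eta_n<1$, and let $\alpha_i,\beta_i,\gamma_i\in\mathbb{R}$ ($i=1,\dots,n$). Set $$\Delta_1=\xi^{1-\sigma}\Gamma(2-\nu)-\Gamma(2-\sigma)\sum_{i=1}^n\alpha_i\eta_i^{1-\nu},\qquad \Delta_2=1-\sum_{i=1}^n(\beta_i\eta_i+\gamma_i),\qquad \Delta_3=-2+\sum_{i=1}^n\eta_i(\beta_i\eta_i+2\gamma_i),$$ and assume $\Delta_1\ne 0$ and $\Delta_2\ne 0$. Define $$\Theta=\frac{1}{\Gamma(q+1)}+\frac{1}{|\Delta_2|\Gamma(q+2)}\Big(1+q+\sum_{i=1}^n\eta_i^q\big(\eta_i|\beta_i|+(q+1)|\gamma_i|\big)\Big)+\frac{\Gamma(2-\sigma)\Gamma(2-\nu)\big(|\Delta_3|+2|\Delta_2|\big)}{2|\Delta_1\Delta_2|}\Big(\frac{\xi^{q-\sigma}}{\Gamma(q-\sigma+1)}+\sum_{i=1}^n|\alpha_i|\frac{\eta_i^{q-\nu}}{\Gamma(q-\nu+1)}\Big).$$ Let $f:[0,1]\times\mathbb{R}\to\mathbb{R}$ be continuous. Assume that there exist a function $p\in C([0,1],\mathbb{R}^+)$ and a nondecreasing function $\psi:\mathbb{R}^+\to\mathbb{R}^+$, where $\mathbb{R}^+=[0,\infty)$, such that $|f(t,x)|\le p(t)\psi(|x|)$ for all $(t,x)\in[0,1]\times\mathbb{R}$,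 and that there exists a constant $M>0$ such that $$\frac{M}{\Theta\,\psi(M)\,\|p\|}>1,\qquad \|p\|=\sup_{t\in[0,1]}|p(t)|.$$ Then the boundary value problem $${}^{c}D^{q}x(t)=f(t,x(t)),\quad t\in[0,1],$$ $${}^{c}D^{\sigma}x(\xi)=\sum_{i=1}^n\alpha_i\,{}^{c}D^{\nu}x(\eta_i),\qquad x(1)=\sum_{i=1}^n\beta_i\int_0^{\eta_i}x(s)\,ds+\sum_{i=1}^n\gamma_i x(\eta_i)$$ has at least one solution on $[0,1]$.
   Context: $\Gamma$ is the Gamma function. For $\mu>0$ and a continuous function $u$ on $[0,1]$, the Riemann-Liouville fractional integral is $I^{\mu}u(t)=\frac{1}{\Gamma(\mu)}\int_0^t (t-s)^{\mu-1}u(s)\,ds$; put $I^0u=u$. ${}^{c}D^{\mu}$ denotes the Caputo fractional derivative of order $\mu$. For $\mu\in(0,1]$ and $x\in C^1[0,1]$, ${}^{c}D^{\mu}x=I^{1-\mu}x'$ (so ${}^{c}D^1x=x'$). For $q\in(1,2]$ and $x\in C^1[0,1]$ such that $z(t):=I^{2-q}\big[x(\cdot)-x(0)-x'(0)\,\cdot\,\big](t)$ belongs to $C^2[0,1]$, ${}^{c}D^{q}x=z''$ (this equals $I^{2-q}x''$ when $x\in C^2[0,1]$, and equals $x''$ when $q=2$). A solution of the boundary value problem is a real function $x\in C^1[0,1]$ for which ${}^{c}D^qx$ exists in this sense, which satisfies the differential equation for all $t\in[0,1]$ and the two boundary conditions. *)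

theory Defs
  imports "HOL-Analysis.Analysis"
begin

text \<open>
  Functions on $[0,1]$ are represented by functions of type \<^typ>\<open>real \<Rightarrow> real\<close>; nothing below depends
  on their values outside $[0,1]$. Accordingly derivatives are taken within $[0,1]$, i.e. they are
  one-sided at the endpoints (so \<open>C1_differentiable_on\<close>, which is two-sided, is not suitable).
\<close>

definition deriv01 :: "(real \<Rightarrow> real) \<Rightarrow> real \<Rightarrow> real" where
  "deriv01 x t = vector_derivative x (at t within {0..1})"

definition C1_01 :: "(real \<Rightarrow> real) \<Rightarrow> bool" where
  "C1_01 x \<longleftrightarrow> (\<forall>t\<in>{0..1}. x differentiable (at t within {0..1})) \<and> continuous_on {0..1} (deriv01 x)"

definition C2_01 :: "(real \<Rightarrow> real) \<Rightarrow> bool" where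
  "C2_01 x \<longleftrightarrow> C1_01 x \<and> C1_01 (deriv01 x)"

text \<open>Riemann-Liouville integral of order \<open>\<mu> \<ge> 0\<close> with base point $0$, evaluated at \<open>t \<in> [0,1]\<close>.\<close>

definition rl_integral :: "real \<Rightarrow> (real \<Rightarrow> real) \<Rightarrow> real \<Rightarrow> real" where
  "rl_integral \<mu> u t =
    (if \<mu> = 0 then u t
     else 1 / Gamma \<mu> * integral {0..t} (\<lambda>s. (t - s) powr (\<mu> - 1) * u s))"

text \<open>
  Caputo derivative of order \<open>\<mu> \<in> (0,2]\<close>. For \<open>\<mu> > 1\<close> it is the second derivative of the fractional
  integral of the first-order Taylor remainder, so that \<open>x\<close> itself need not be twice differentiable.
  The value of \<open>caputo\<close> is meaningful only if \<open>caputo_differentiable\<close> holds.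
\<close>

definition caputo_aux :: "real \<Rightarrow> (real \<Rightarrow> real) \<Rightarrow> real \<Rightarrow> real" where
  "caputo_aux \<mu> x = rl_integral (2 - \<mu>) (\<lambda>s. x s - x 0 - deriv01 x 0 * s)"

definition caputo_differentiable :: "real \<Rightarrow> (real \<Rightarrow> real) \<Rightarrow> bool" where
  "caputo_differentiable \<mu> x \<longleftrightarrow> C1_01 x \<and> (1 < \<mu> \<longrightarrow> C2_01 (caputo_aux \<mu> x))"

definition caputo :: "real \<Rightarrow> (real \<Rightarrow> real) \<Rightarrow> real \<Rightarrow> real" where
  "caputo \<mu> x =
    (if \<mu> \<le> 1 then rl_integral (1 - \<mu>) (deriv01 x)
     else deriv01 (deriv01 (caputo_aux \<mu> x)))"

end

theory Submission
  imports Defs "HOL-Complex_Analysis.Great_Picard"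
begin

text \<open>
  For continuous \<open>h\<close>, the linear problem with right-hand side \<open>h\<close> is solved by
  \<open>S h = I\<^sup>q h + a(h) + b(h) t\<close>, where the two boundary conditions determine \<open>b(h)\<close> (divide by
  \<open>\<Delta>\<^sub>1\<close>) and then \<open>a(h)\<close> (divide by \<open>\<Delta>\<^sub>2\<close>); the constant \<open>\<Theta>\<close> is exactly the resulting bound for
  the operator norm of \<open>S\<close> on \<open>C[0,1]\<close>. Hence \<open>x \<mapsto> S (f(\<cdot>, x(\<cdot>)))\<close> maps the ball of radius \<open>M\<close>
  into itself, because \<open>\<Theta> \<psi>(M) \<parallel>p\<parallel> < M\<close>, and its image is equi-Lipschitz, so Schauder's theorem gives a
  fixed point. Schauder's theorem is reduced to a finite-dimensional cube, where Kuhn's combinatorial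
  lemma applies; its dimension is a natural number, whereas Brouwer's theorem in the library is
  about a Euclidean type. The calculus of \<open>I\<^sup>\<mu>\<close> (continuity, semigroup law) is checked on monomials by
  the Beta integral and extended to continuous functions by Weierstrass approximation.
\<close>

subsection \<open>Fixed points in coordinate cubes\<close>

text \<open>Tychonoff's theorem. Coordinates from \<open>m\<close> on are frozen at 0, so cubes of
  every dimension lie in the one type \<open>nat \<Rightarrow> real\<close> and \<open>m\<close> can
  be an ordinary variable.\<close>

lemma compact_coordinate_cube:
  "compact {y :: nat \<Rightarrow> real. \<forall>i. y i \<in> (if i < m then {0..1} else {0})}"
proof -
  have "compactin (product_topology (\<lambda>i::nat. euclidean :: real topology) UNIV)
          (PiE UNIV (\<lambda>i. if i < m then {0..1} else {0}))"
    by (auto simp: compactin_PiE)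
  then have "compact (PiE UNIV (\<lambda>i::nat. if i < m then {0..1::real} else {0}))"
    by (simp add: euclidean_product_topology)
  also have "PiE UNIV (\<lambda>i. if i < m then {0..1} else {0})
      = {y :: nat \<Rightarrow> real. \<forall>i. y i \<in> (if i < m then {0..1} else {0})}"
    by (auto simp: PiE_def Pi_def)
  finally show ?thesis .
qed

text \<open>Label each point of the grid of mesh \<open>1 / Suc k\<close> in coordinate
  \<open>i\<close> by whether \<open>G\<close> moves that coordinate up (0) or down (1). Kuhn's
  lemma yields a single grid cell in which every coordinate sees both labels; \<open>r\<close> and
  \<open>s\<close> are vertices of this cell and depend on \<open>i\<close>.\<close>

lemma kuhn_approximate_fixpoint:
  fixes G :: "(nat \<Rightarrow> real) \<Rightarrow> nat \<Rightarrow> real" and k m :: nat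
  defines "Q \<equiv> {y :: nat \<Rightarrow> real. \<forall>i. y i \<in> (if i < m then {0..1} else {0})}"
  assumes GQ: "\<And>y i. y \<in> Q \<Longrightarrow> i < m \<Longrightarrow> G y i \<in> {0..1}"
  shows "\<exists>z\<in>Q. \<forall>i<m. \<exists>r\<in>Q. \<exists>s\<in>Q. (\<forall>j. \<bar>r j - z j\<bar> \<le> 1 / Suc k) \<and> (\<forall>j. \<bar>s j - z j\<bar> \<le> 1 / Suc k)
           \<and> r i \<le> G r i \<and> G s i \<le> s i"
proof -
  define p where "p = Suc k"
  define g :: "(nat \<Rightarrow> nat) \<Rightarrow> nat \<Rightarrow> real" where "g = (\<lambda>x i. if i < m then x i / p else 0)"
  \<comment> \<open>Kuhn's lemma prescribes label 0 on the face \<open>y i = 0\<close> and label 1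
    on the face \<open>y i = 1\<close>. Both agree with the meaning of the labels because
    \<open>G y i\<close> lies in [0,1].\<close>
  define lab where
    "lab = (\<lambda>y i. if y i = 0 then 0::nat else if y i = 1 \<or> G y i \<le> y i then 1 else 0)"
  have p: "0 < p" by (simp add: p_def)
  have gQ: "g x \<in> Q" if "\<forall>i<m. x i \<le> p" for x
    using that p by (auto simp: g_def Q_def divide_simps)
  have lab01: "lab y i = 0 \<Longrightarrow> y i \<le> G y i" "lab y i \<noteq> 0 \<Longrightarrow> G y i \<le> y i"
    if "y \<in> Q" "i < m" for y i
    using GQ[OF that] that by (auto simp: lab_def split: if_splits)
  obtain c where c: "\<forall>i<m. c i < p"
    and lr: "\<forall>i<m. \<exists>r s. (\<forall>j<m. c j \<le> r j \<and> r j \<le> c j + 1) \<and> (\<forall>j<m. c j \<le> s j \<and> s j \<le> c j + 1)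
                    \<and> lab (g r) i \<noteq> lab (g s) i"
    by (rule kuhn_lemma[of p m "\<lambda>x. lab (g x)"]) (use p in \<open>auto simp: lab_def g_def\<close>)
  have near: "g x \<in> Q" "\<bar>g x j - g c j\<bar> \<le> 1 / p" if "\<forall>j<m. c j \<le> x j \<and> x j \<le> c j + 1" for x j
  proof -
    show "g x \<in> Q" by (rule gQ) (use that c in fastforce)
    have "real (x j) - real (c j) \<in> {0..1}" if "j < m"
      using \<open>\<forall>j<m. c j \<le> x j \<and> x j \<le> c j + 1\<close> that by (force simp flip: of_nat_diff)
    then show "\<bar>g x j - g c j\<bar> \<le> 1 / p"
      using p by (auto simp: g_def simp flip: diff_divide_distrib intro: divide_right_mono)
  qed
  show ?thesis
  proof (rule bexI[of _ "g c"], intro allI impI)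
    show "g c \<in> Q" using c by (intro gQ) (auto intro: less_imp_le)
    fix i assume i: "i < m"
    obtain r s where rs: "\<forall>j<m. c j \<le> r j \<and> r j \<le> c j + 1" "\<forall>j<m. c j \<le> s j \<and> s j \<le> c j + 1"
      "lab (g r) i \<noteq> lab (g s) i"
      using lr i by blast
    note * = near[OF rs(1)] near[OF rs(2)]
    show "\<exists>r\<in>Q. \<exists>s\<in>Q. (\<forall>j. \<bar>r j - g c j\<bar> \<le> 1 / Suc k) \<and> (\<forall>j. \<bar>s j - g c j\<bar> \<le> 1 / Suc k)
           \<and> r i \<le> G r i \<and> G s i \<le> s i"
    proof (cases "lab (g r) i = 0")
      case True
      then show ?thesis using rs(3) * lab01[of _ i] i
        by (intro bexI[of _ "g r"] bexI[of _ "g s"]) (auto simp: p_def)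
    next
      case False
      then have "lab (g s) i = 0" using rs(3) by (auto simp: lab_def split: if_splits)
      then show ?thesis using False * lab01[of _ i] i
        by (intro bexI[of _ "g s"] bexI[of _ "g r"]) (auto simp: p_def)
    qed
  qed
qed

text \<open>By compactness the cells of ever finer grids accumulate at some \<open>y\<close>. For
  each coordinate the two witnesses in these cells tend to the same \<open>y\<close>, so continuity
  turns their opposite inequalities into an equality.\<close>

lemma brouwer_coordinate_cube:
  fixes G :: "(nat \<Rightarrow> real) \<Rightarrow> nat \<Rightarrow> real" and m :: nat
  defines "Q \<equiv> {y :: nat \<Rightarrow> real. \<forall>i. y i \<in> (if i < m then {0..1} else {0})}"
  assumes cont: "\<And>i. i < m \<Longrightarrow> continuous_on Q (\<lambda>y. G y i)"
    and GQ: "\<And>y i. y \<in> Q \<Longrightarrow> i < m \<Longrightarrow> G y i \<in> {0..1}"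
  shows "\<exists>y\<in>Q. \<forall>i<m. G y i = y i"
proof -
  have "\<forall>k. \<exists>z\<in>Q. \<forall>i<m. \<exists>r\<in>Q. \<exists>s\<in>Q. (\<forall>j. \<bar>r j - z j\<bar> \<le> 1 / Suc k)
           \<and> (\<forall>j. \<bar>s j - z j\<bar> \<le> 1 / Suc k) \<and> r i \<le> G r i \<and> G s i \<le> s i"
    using kuhn_approximate_fixpoint[of m G] GQ unfolding Q_def by blast
  then obtain z where zQ: "\<And>k. z k \<in> Q" and z: "\<And>k i. i < m \<Longrightarrow> \<exists>r\<in>Q. \<exists>s\<in>Q.
      (\<forall>j. \<bar>r j - z k j\<bar> \<le> 1 / Suc k) \<and> (\<forall>j. \<bar>s j - z k j\<bar> \<le> 1 / Suc k) \<and> r i \<le> G r i \<and> G s i \<le> s i"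
    by metis
  have "seq_compact Q"
    unfolding Q_def by (intro compact_imp_seq_compact compact_coordinate_cube)
  then obtain y \<phi> where y: "y \<in> Q" and \<phi>: "strict_mono (\<phi> :: nat \<Rightarrow> nat)" and zy: "(z \<circ> \<phi>) \<longlonglongrightarrow> y"
    using zQ unfolding seq_compact_def by metis
  have zyj: "(\<lambda>k. z (\<phi> k) j) \<longlonglongrightarrow> y j" for j
  proof -
    have "continuous_on UNIV (\<lambda>x::nat \<Rightarrow> real. x j)"
      by (rule continuous_on_product_coordinates)
    from continuous_on_tendsto_compose[OF this zy] show ?thesis by simp
  qed
  have inv: "(\<lambda>k. 1 / real (Suc (\<phi> k))) \<longlonglongrightarrow> 0"
    using LIMSEQ_subseq_LIMSEQ[OF LIMSEQ_inverse_real_of_nat \<phi>] by (simp add: o_def inverse_eq_divide)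
  have lim: "(\<lambda>k. G (w (\<phi> k)) i) \<longlonglongrightarrow> G y i" "(\<lambda>k. w (\<phi> k) i) \<longlonglongrightarrow> y i"
    if w: "\<And>k. w k \<in> Q" "\<And>k j. \<bar>w k j - z k j\<bar> \<le> 1 / Suc k" and i: "i < m" for w i
  proof -
    have wj: "(\<lambda>k. w (\<phi> k) j) \<longlonglongrightarrow> y j" for j
    proof -
      have "(\<lambda>k. w (\<phi> k) j - z (\<phi> k) j) \<longlonglongrightarrow> 0"
        by (rule Lim_null_comparison[OF _ inv]) (use w(2) in auto)
      from tendsto_add[OF this zyj[of j]] show ?thesis by simp
    qed
    then show "(\<lambda>k. w (\<phi> k) i) \<longlonglongrightarrow> y i" .
    have "(\<lambda>k. w (\<phi> k)) \<longlonglongrightarrow> y"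
      using wj by (simp add: euclidean_product_topology[symmetric] limitin_componentwise
          flip: limitin_canonical_iff)
    then show "(\<lambda>k. G (w (\<phi> k)) i) \<longlonglongrightarrow> G y i"
      using continuous_on_tendsto_compose[OF cont[OF i], of "\<lambda>k. w (\<phi> k)" y] y w(1) by simp
  qed
  have "G y i = y i" if i: "i < m" for i
  proof -
    obtain r s where r: "\<And>k. r k \<in> Q" "\<And>k j. \<bar>r k j - z k j\<bar> \<le> 1 / Suc k" "\<And>k. r k i \<le> G (r k) i"
      and s: "\<And>k. s k \<in> Q" "\<And>k j. \<bar>s k j - z k j\<bar> \<le> 1 / Suc k" "\<And>k. G (s k) i \<le> s k i"
      using z[OF i] by metis
    have "y i \<le> G y i"
      by (rule LIMSEQ_le[OF lim(2)[OF r(1,2) i] lim(1)[OF r(1,2) i]]) (use r(3) in auto)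
    moreover have "G y i \<le> y i"
      by (rule LIMSEQ_le[OF lim(1)[OF s(1,2) i] lim(2)[OF s(1,2) i]]) (use s(3) in auto)
    ultimately show ?thesis by simp
  qed
  then show ?thesis using y by blast
qed

subsection \<open>Schauder's theorem\<close>

text \<open>Schauder projection: a finite \<open>e\<close>-net of \<open>K\<close> carries a
  partition of unity, and a point is encoded by its weights on the net. \<open>G\<close> sends
  weights \<open>y\<close> to the partition weights of \<open>F (X y)\<close>; a fixed point from
  Brouwer's theorem gives a point \<open>X y\<close> that is an average of net points near its own
  image.\<close>

lemma schauder_approximate_fixpoint:
  fixes F :: "'a::real_normed_vector \<Rightarrow> 'a"
  assumes C: "convex C" "C \<noteq> {}" and F: "continuous_on C F"
    and K: "compact K" "K \<subseteq> C" "F ` C \<subseteq> K" and e: "0 < e"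
  shows "\<exists>x\<in>C. norm (F x - x) \<le> e"
proof -
  obtain D where D: "D \<subseteq> K" "finite D" "K \<subseteq> (\<Union>k\<in>D. ball k e)"
    by (rule compactE_image[OF K(1), of K "\<lambda>k. ball k e"]) (use e in auto)
  obtain \<kappa> and m :: nat where \<kappa>: "D = \<kappa> ` {..<m}"
    using finite_imp_nat_seg_image_inj_on[OF D(2)] by (auto simp: lessThan_def)
  have "D \<noteq> {}" using D(3) K(3) C(2) by auto
  then have m: "0 < m" using \<kappa> by auto
  have \<kappa>C: "\<kappa> i \<in> C" if "i < m" for i using that \<kappa> D(1) K(2) by auto
  define Q where "Q = {y :: nat \<Rightarrow> real. \<forall>i. y i \<in> (if i < m then {0..1} else {0})}"
  have Q: "0 \<le> y i" if "y \<in> Q" for y i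
    using that by (auto simp: Q_def split: if_splits dest: spec[of _ i])
  \<comment> \<open>\<open>X\<close> maps the whole cube (not only the simplex) into \<open>C\<close>: weights of sum above 1 are rescaled and
    a deficit below 1 is given to \<open>\<kappa> 0\<close>. At a fixed point of \<open>G\<close> the weights sum to 1.\<close>
  define s where "s = (\<lambda>y::nat \<Rightarrow> real. max 1 (\<Sum>i<m. y i))"
  define w where "w = (\<lambda>y i. y i / s y + (if i = 0 then 1 - (\<Sum>i<m. y i) / s y else 0))"
  define X where "X = (\<lambda>y. \<Sum>i<m. w y i *\<^sub>R \<kappa> i)"
  \<comment> \<open>Tent functions around the net points: \<open>\<phi> i v\<close> is positive
    exactly when \<open>v\<close> is closer than \<open>e\<close> to \<open>\<kappa> i\<close>. The
    net property therefore makes their sum positive on \<open>K\<close>, where \<open>G\<close>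
    divides by it.\<close>
  define \<phi> where "\<phi> = (\<lambda>i v. max 0 (e - dist v (\<kappa> i)))"
  define G where "G = (\<lambda>y i. \<phi> i (F (X y)) / (\<Sum>j<m. \<phi> j (F (X y))))"
  have s: "1 \<le> s y" "(\<Sum>i<m. y i) \<le> s y" for y by (auto simp: s_def)
  have XC: "X y \<in> C" if "y \<in> Q" for y
    unfolding X_def
  proof (rule convex_sum)
    show "(\<Sum>i<m. w y i) = 1"
      using m s(1)[of y] by (simp add: w_def sum.distrib flip: sum_divide_distrib)
    show "0 \<le> w y i" for i
      using Q[OF that, of i] s[of y] by (auto simp: w_def intro!: add_nonneg_nonneg)
  qed (use C \<kappa>C in auto)
  have \<phi>: "0 \<le> \<phi> i v" for i v by (simp add: \<phi>_def)
  have \<Phi>: "0 < (\<Sum>j<m. \<phi> j v)" if v: "v \<in> K" for v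
  proof -
    obtain i where "i < m" "dist (\<kappa> i) v < e"
      using subsetD[OF D(3) v] \<kappa> by auto
    then show ?thesis
      by (intro sum_pos2[of _ i]) (auto simp: \<phi>_def dist_commute)
  qed
  have FK: "F (X y) \<in> K" if "y \<in> Q" for y using XC[OF that] K(3) by auto
  have coord: "continuous_on Q (\<lambda>y. y i)" for i
    by (rule continuous_on_subset[OF continuous_on_product_coordinates]) auto
  have "continuous_on Q (\<lambda>y. w y i)" for i
    unfolding w_def s_def
    by (cases "i = 0") (auto intro!: continuous_intros continuous_on_max coord simp: max.strict_coboundedI1)
  then have contX: "continuous_on Q X"
    unfolding X_def by (intro continuous_intros)
  have contFX: "continuous_on Q (\<lambda>y. F (X y))"
    by (rule continuous_on_compose2[OF F contX]) (use XC in auto)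
  have "\<exists>y\<in>Q. \<forall>i<m. G y i = y i"
    unfolding Q_def
  proof (rule brouwer_coordinate_cube, fold Q_def)
    fix i
    show "continuous_on Q (\<lambda>y. G y i)"
      unfolding G_def \<phi>_def
      by (intro continuous_intros contFX) (use \<Phi>[OF FK] in \<open>force simp: \<phi>_def\<close>)
    fix y assume "y \<in> Q" "i < m"
    then have "\<phi> i (F (X y)) \<le> (\<Sum>j<m. \<phi> j (F (X y)))"
      by (intro member_le_sum) (use \<phi> in auto)
    then show "G y i \<in> {0..1}" using \<Phi>[OF FK[OF \<open>y \<in> Q\<close>]] \<phi>
      by (simp add: G_def)
  qed
  then obtain y where yQ: "y \<in> Q" and y: "\<And>i. i < m \<Longrightarrow> y i = G y i" by force
  let ?v = "F (X y)"
  have y1: "(\<Sum>i<m. y i) = 1"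
    using \<Phi>[OF FK[OF yQ]] y by (simp add: G_def flip: sum_divide_distrib)
  then have "s y = 1" by (simp add: s_def)
  then have "w y i = y i" for i using y1 by (simp add: w_def)
  then have Xy: "X y = (\<Sum>i<m. y i *\<^sub>R \<kappa> i)" by (simp add: X_def)
  \<comment> \<open>Since the weights sum to 1, the displacement is an average of differences to net
    points; net points farther than \<open>e\<close> from \<open>?v\<close> have weight 0.\<close>
  have "?v - X y = (\<Sum>i<m. y i *\<^sub>R (?v - \<kappa> i))"
    using y1 by (simp add: Xy scaleR_right_diff_distrib sum_subtractf flip: scaleR_sum_left)
  also have "norm \<dots> \<le> (\<Sum>i<m. y i * e)"
  proof (rule sum_norm_le)
    fix i assume "i \<in> {..<m}"
    then have i: "i < m" by simp
    show "norm (y i *\<^sub>R (?v - \<kappa> i)) \<le> y i * e"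
    proof (cases "norm (?v - \<kappa> i) \<le> e")
      case True
      then show ?thesis using Q[OF yQ, of i] by (simp add: mult_left_mono)
    next
      case False
      then have "y i = 0" using y[OF i] by (simp add: G_def \<phi>_def dist_norm)
      then show ?thesis by simp
    qed
  qed
  also have "\<dots> = e" using y1 by (simp flip: sum_distrib_right)
  finally show ?thesis using XC[OF yQ] by blast
qed

text \<open>The convergent subsequence is taken among the images \<open>F (x k)\<close>, because
  compactness is available for \<open>K\<close> and not for \<open>C\<close>. The points
  \<open>x k\<close> follow to the same limit, being asymptotically close to their images.\<close>

theorem schauder_fixpoint:
  fixes F :: "'a::real_normed_vector \<Rightarrow> 'a"
  assumes C: "convex C" "C \<noteq> {}" and F: "continuous_on C F"
    and K: "compact K" "K \<subseteq> C" "F ` C \<subseteq> K"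
  shows "\<exists>x\<in>C. F x = x"
proof -
  have "\<forall>k. \<exists>x\<in>C. norm (F x - x) \<le> 1 / Suc k"
    using schauder_approximate_fixpoint[OF assms] by simp
  then obtain x where xC: "\<And>k. x k \<in> C" and x: "\<And>k. norm (F (x k) - x k) \<le> 1 / Suc k"
    by metis
  obtain v \<phi> where v: "v \<in> K" and \<phi>: "strict_mono (\<phi> :: nat \<Rightarrow> nat)"
    and lim: "((\<lambda>k. F (x k)) \<circ> \<phi>) \<longlonglongrightarrow> v"
    using K(1,3) xC unfolding compact_eq_seq_compact_metric seq_compact_def by (metis image_subset_iff)
  have "(\<lambda>k. 1 / real (Suc (\<phi> k))) \<longlonglongrightarrow> 0"
    using LIMSEQ_subseq_LIMSEQ[OF LIMSEQ_inverse_real_of_nat \<phi>] by (simp add: o_def inverse_eq_divide)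
  then have "(\<lambda>k. F (x (\<phi> k)) - x (\<phi> k)) \<longlonglongrightarrow> 0"
    by (rule Lim_null_comparison[rotated]) (use x in auto)
  from tendsto_diff[OF lim this] have "(\<lambda>k. x (\<phi> k)) \<longlonglongrightarrow> v" by (simp add: o_def)
  then have "(\<lambda>k. F (x (\<phi> k))) \<longlonglongrightarrow> F v"
    by (rule continuous_on_tendsto_compose[OF F]) (use v K(2) xC in auto)
  then have "F v = v" using lim by (auto simp: o_def intro: LIMSEQ_unique)
  then show ?thesis using v K(2) by blast
qed

subsection \<open>Integral equations on the unit interval\<close>

text \<open>The space C[0,1] is modelled inside the normed type of bounded continuous functions on
  the line, by functions that factor through a retraction \<open>c\<close> onto [0,1]. Arzela-Ascoli
  is applied on [0,1], and the limit is transported to the line by composition with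
  \<open>c\<close>; the defining conditions survive pointwise limits.\<close>

lemma compact_equilipschitz_bcontfun:
  fixes c :: "real \<Rightarrow> real"
  assumes L: "0 \<le> L" and c: "continuous_on UNIV c" "\<And>t. c t \<in> {0..1}" "\<And>t. t \<in> {0..1} \<Longrightarrow> c t = t"
  shows "compact {v :: real \<Rightarrow>\<^sub>C real. norm v \<le> M
    \<and> (\<forall>s t. \<bar>apply_bcontfun v t - apply_bcontfun v s\<bar> \<le> L * \<bar>t - s\<bar>)
    \<and> (\<forall>t. apply_bcontfun v t = apply_bcontfun v (c t))}"
    (is "compact ?K")
  unfolding compact_eq_seq_compact_metric seq_compact_def
proof (intro allI impI)
  fix v :: "nat \<Rightarrow> real \<Rightarrow>\<^sub>C real"
  assume v: "\<forall>n. v n \<in> ?K"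
  then have vb: "\<bar>v n t\<bar> \<le> M" and vl: "\<bar>v n t - v n s\<bar> \<le> L * \<bar>t - s\<bar>" and vc: "v n t = v n (c t)" for n s t
    using norm_bounded[of "v n" t] by (auto intro: order_trans)
  obtain g \<phi> where g: "continuous_on {0..1} g" and \<phi>: "strict_mono (\<phi> :: nat \<Rightarrow> nat)"
    and lim: "\<And>e. 0 < e \<Longrightarrow> \<exists>N. \<forall>n x. n \<ge> N \<and> x \<in> {0..1} \<longrightarrow> norm (v (\<phi> n) x - g x) < e"
  proof (rule Arzela_Ascoli[of "{0..1::real}" "\<lambda>n. apply_bcontfun (v n)" M])
    fix x e :: real assume "0 < e"
    show "\<exists>d>0. \<forall>n y. y \<in> {0..1} \<and> norm (x - y) < d \<longrightarrow> norm (v n x - v n y) < e"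
    proof (intro exI conjI allI impI)
      \<comment> \<open>The denominator \<open>L + 1\<close> covers the case
        \<open>L = 0\<close>.\<close>
      show "0 < e / (L + 1)" using \<open>0 < e\<close> L by simp
      fix n y assume "y \<in> {0..1} \<and> norm (x - y) < e / (L + 1)"
      then have "(L + 1) * \<bar>x - y\<bar> < e" using L by (simp add: field_simps)
      moreover have "L * \<bar>x - y\<bar> \<le> (L + 1) * \<bar>x - y\<bar>" by (simp add: mult_right_mono)
      ultimately show "norm (v n x - v n y) < e" using vl[of n x y] by simp
    qed
  qed (use vb in auto)
  have "continuous_on UNIV (g \<circ> c)"
    using c g by (metis UNIV_I continuous_on_compose continuous_on_subset image_subsetI)
  moreover have "bounded (range (g \<circ> c))"
    using compact_imp_bounded[OF compact_continuous_image[OF g]] c(2)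
    by (force intro: bounded_subset)
  ultimately have w: "apply_bcontfun (Bcontfun (g \<circ> c)) = g \<circ> c"
    by (intro Bcontfun_inverse) (simp add: bcontfun_def)
  have wt: "Bcontfun (g \<circ> c) t = g (c t)" for t by (simp add: w)
  have tend: "(v \<circ> \<phi>) \<longlonglongrightarrow> Bcontfun (g \<circ> c)"
  proof (rule uniform_limit_tendsto_bcontfun, unfold w, rule uniform_limitI)
    fix e :: real assume "0 < e"
    then obtain N where "\<forall>n x. n \<ge> N \<and> x \<in> {0..1} \<longrightarrow> norm (v (\<phi> n) x - g x) < e"
      using lim by blast
    then have "\<bar>v (\<phi> n) (c x) - g (c x)\<bar> < e" if "n \<ge> N" for n x
      using c(2) that by auto
    then show "\<forall>\<^sub>F n in sequentially. \<forall>x\<in>UNIV. dist ((v \<circ> \<phi>) n x) ((g \<circ> c) x) < e"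
      using vc by (auto simp: eventually_sequentially dist_real_def intro!: exI[of _ N])
  qed
  have pt: "(\<lambda>n. v (\<phi> n) t) \<longlonglongrightarrow> g (c t)" for t
    using tendsto_uniform_limitI[OF tendsto_bcontfun_uniform_limit[OF tend], of t] by (simp add: w)
  have "Bcontfun (g \<circ> c) \<in> ?K"
  proof (intro CollectI conjI allI norm_bound)
    fix s t
    show "norm (Bcontfun (g \<circ> c) t) \<le> M"
      unfolding wt real_norm_def by (rule LIMSEQ_le_const2[OF tendsto_rabs[OF pt]]) (use vb in auto)
    show "\<bar>Bcontfun (g \<circ> c) t - Bcontfun (g \<circ> c) s\<bar> \<le> L * \<bar>t - s\<bar>"
      unfolding wt by (rule LIMSEQ_le_const2[OF tendsto_rabs[OF tendsto_diff[OF pt pt]]]) (use vl in auto)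
    show "Bcontfun (g \<circ> c) t = Bcontfun (g \<circ> c) (c t)"
      unfolding wt using c(2,3) by metis
  qed
  then show "\<exists>l\<in>?K. \<exists>r. strict_mono r \<and> (v \<circ> r) \<longlonglongrightarrow> l"
    using \<phi> tend by blast
qed

text \<open>This separates the fixed point argument from fractional calculus: \<open>S\<close> is
  any solution operator of a linear problem. The bound gives the invariant ball, the Lipschitz
  estimate gives a compact image, and compatibility with differences combined with the bound gives
  continuity.\<close>

lemma nonlinear_integral_equation_solvable:
  fixes S :: "(real \<Rightarrow> real) \<Rightarrow> real \<Rightarrow> real" and f :: "real \<Rightarrow> real \<Rightarrow> real"
  assumes f: "continuous_on ({0..1} \<times> UNIV) (\<lambda>(t, x). f t x)"
    and fm: "\<And>t x. t \<in> {0..1} \<Longrightarrow> \<bar>x\<bar> \<le> M \<Longrightarrow> \<bar>f t x\<bar> \<le> m"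
    and diff: "\<And>h k t. continuous_on {0..1} h \<Longrightarrow> continuous_on {0..1} k \<Longrightarrow> t \<in> {0..1}
                 \<Longrightarrow> S (\<lambda>s. h s - k s) t = S h t - S k t"
    and bnd: "\<And>h C t. continuous_on {0..1} h \<Longrightarrow> (\<And>s. s \<in> {0..1} \<Longrightarrow> \<bar>h s\<bar> \<le> C) \<Longrightarrow> t \<in> {0..1}
                 \<Longrightarrow> \<bar>S h t\<bar> \<le> \<Theta> * C"
    and lip: "\<And>h C s t. continuous_on {0..1} h \<Longrightarrow> (\<And>s. s \<in> {0..1} \<Longrightarrow> \<bar>h s\<bar> \<le> C)
                 \<Longrightarrow> s \<in> {0..1} \<Longrightarrow> t \<in> {0..1} \<Longrightarrow> \<bar>S h t - S h s\<bar> \<le> L * C * \<bar>t - s\<bar>"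
    and "0 \<le> M" "\<Theta> * m \<le> M"
  shows "\<exists>u. continuous_on {0..1} u \<and> (\<forall>t\<in>{0..1}. u t = S (\<lambda>s. f s (u s)) t)"
proof -
  define c :: "real \<Rightarrow> real" where "c = (\<lambda>t. max 0 (min 1 t))"
  have c: "continuous_on UNIV c" "c t \<in> {0..1}" "t \<in> {0..1} \<Longrightarrow> c t = t" "\<bar>c t - c s\<bar> \<le> \<bar>t - s\<bar>" for s t
    by (auto simp: c_def intro!: continuous_intros)
  define N where "N = (\<lambda>v :: real \<Rightarrow>\<^sub>C real. \<lambda>s. f s (v s))"
  define F where "F = (\<lambda>v. Bcontfun (\<lambda>t. S (N v) (c t)))"
  define K where "K = {v :: real \<Rightarrow>\<^sub>C real. norm v \<le> M
    \<and> (\<forall>s t. \<bar>apply_bcontfun v t - apply_bcontfun v s\<bar> \<le> L * m * \<bar>t - s\<bar>)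
    \<and> (\<forall>t. apply_bcontfun v t = apply_bcontfun v (c t))}"
  \<comment> \<open>The signs of \<open>L\<close> and \<open>\<Theta>\<close> come from testing the
    estimates on the constant function 1, that of \<open>m\<close> from the bound on
    \<open>f\<close>.\<close>
  have "0 \<le> L" using lip[of "\<lambda>_. 1" 1 0 1] by simp
  have "0 \<le> \<Theta>" using bnd[of "\<lambda>_. 1" 1 0] by simp
  have "0 \<le> m" using fm[of 0 0] \<open>0 \<le> M\<close> by simp
  then have "0 \<le> L * m" using \<open>0 \<le> L\<close> by simp
  have N: "continuous_on {0..1} (N v)" for v
  proof -
    have "continuous_on {0..1} (\<lambda>s. (\<lambda>(t, x). f t x) (s, v s))"
      by (rule continuous_on_compose2[OF f]) (auto intro!: continuous_intros)
    then show ?thesis by (simp add: N_def)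
  qed
  have vM: "\<bar>v t\<bar> \<le> M" if "v \<in> cball 0 M" for v :: "real \<Rightarrow>\<^sub>C real" and t
    using norm_bounded[of v t] that by (auto intro: order_trans)
  have Nm: "\<bar>N v s\<bar> \<le> m" if "v \<in> cball 0 M" "s \<in> {0..1}" for v s
    using fm vM that by (simp add: N_def)
  have SM: "\<bar>S (N v) (c t)\<bar> \<le> M" if "v \<in> cball 0 M" for v t
    using bnd[OF N Nm[OF that] c(2)] \<open>\<Theta> * m \<le> M\<close> by (rule order_trans)
  have Sl: "\<bar>S (N v) (c t) - S (N v) (c s)\<bar> \<le> L * m * \<bar>t - s\<bar>" if "v \<in> cball 0 M" for v s t
    using lip[OF N Nm[OF that] c(2) c(2)] mult_left_mono[OF c(4) \<open>0 \<le> L * m\<close>] by (rule order_trans)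
  \<comment> \<open>\<open>Bcontfun\<close> can be evaluated only once its argument is known to be
    bounded and continuous; the estimates for this hold on the ball.\<close>
  have app: "apply_bcontfun (F v) = (\<lambda>t. S (N v) (c t))" if "v \<in> cball 0 M" for v
    unfolding F_def
  proof (rule Bcontfun_inverse, rule bcontfun_normI)
    have "(L * m)-lipschitz_on UNIV (\<lambda>t. S (N v) (c t))"
      using Sl[OF that] \<open>0 \<le> L * m\<close> by (intro lipschitz_onI) (auto simp: dist_real_def)
    then show "continuous_on UNIV (\<lambda>t. S (N v) (c t))" by (rule lipschitz_on_continuous_on)
  qed (use SM[OF that] in auto)
  have "\<exists>v\<in>cball 0 M. F v = v"
  proof (rule schauder_fixpoint)
    show "convex (cball 0 M :: (real \<Rightarrow>\<^sub>C real) set)" "cball 0 M \<noteq> ({} :: (real \<Rightarrow>\<^sub>C real) set)"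
      using \<open>0 \<le> M\<close> by auto
    show "compact K" unfolding K_def
      by (rule compact_equilipschitz_bcontfun) (use c \<open>0 \<le> L * m\<close> in auto)
    show "K \<subseteq> cball 0 M" by (auto simp: K_def)
    show "F ` cball 0 M \<subseteq> K"
    proof (rule image_subsetI)
      fix v :: "real \<Rightarrow>\<^sub>C real" assume v: "v \<in> cball 0 M"
      have "c (c t) = c t" for t using c(2,3) by blast
      then show "F v \<in> K" using SM[OF v] Sl[OF v] norm_bound[of "F v" M] by (auto simp: K_def app[OF v])
    qed
    show "continuous_on (cball 0 M) F"
      unfolding continuous_on_iff
    proof (intro ballI allI impI)
      fix v :: "real \<Rightarrow>\<^sub>C real" and e :: real assume v: "v \<in> cball 0 M" and "0 < e"
      \<comment> \<open>Adding 1 keeps the quotient meaningful for \<open>\<Theta> = 0\<close> and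
        makes \<open>\<Theta> * e' < e\<close> strict.\<close>
      define e' where "e' = e / (\<Theta> + 1)"
      have e': "0 < e'" "\<Theta> * e' < e"
        using \<open>0 < e\<close> \<open>0 \<le> \<Theta>\<close> by (auto simp: e'_def field_simps)
      \<comment> \<open>On this compact strip, which contains the graphs of all functions in the
        ball over [0,1], \<open>f\<close> is uniformly continuous; hence uniformly close
        \<open>w\<close> and \<open>v\<close> have uniformly close \<open>N w\<close> and
        \<open>N v\<close>.\<close>
      have "uniformly_continuous_on ({0..1} \<times> {-M..M}) (\<lambda>(t, x). f t x)"
        by (intro compact_uniformly_continuous continuous_on_subset[OF f] compact_Times) auto
      then obtain d where d: "0 < d" and fd: "\<And>t x y. \<lbrakk>t \<in> {0..1}; x \<in> {-M..M}; y \<in> {-M..M}; \<bar>y - x\<bar> < d\<rbrakk>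
          \<Longrightarrow> \<bar>f t y - f t x\<bar> < e'"
        using e'(1) unfolding uniformly_continuous_on_def
        by (fastforce simp: dist_Pair_Pair dist_real_def)
      show "\<exists>d>0. \<forall>w\<in>cball 0 M. dist w v < d \<longrightarrow> dist (F w) (F v) < e"
      proof (intro exI conjI ballI impI)
        fix w assume w: "w \<in> cball 0 M" and "dist w v < d"
        have "\<bar>N w s - N v s\<bar> \<le> e'" if "s \<in> {0..1}" for s
        proof -
          have "dist (w s) (v s) < d" using dist_bounded[of w s v] \<open>dist w v < d\<close> by (rule le_less_trans)
          then have "\<bar>f s (w s) - f s (v s)\<bar> < e'"
            using vM[OF w, of s] vM[OF v, of s] that by (intro fd) (auto simp: dist_real_def abs_le_iff)
          then show ?thesis by (simp add: N_def)
        qed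
        from bnd[OF continuous_on_diff[OF N N] this c(2)]
        have "\<bar>S (N w) (c t) - S (N v) (c t)\<bar> \<le> \<Theta> * e'" for t
          by (simp add: diff[OF N N c(2)])
        then have "dist (F w) (F v) \<le> \<Theta> * e'"
          by (intro dist_bound) (simp add: app[OF v] app[OF w] dist_real_def)
        then show "dist (F w) (F v) < e" using e'(2) by simp
      qed (rule d)
    qed
  qed
  then obtain v where v: "v \<in> cball 0 M" "F v = v" by blast
  have "v t = S (\<lambda>s. f s (v s)) t" if "t \<in> {0..1}" for t
    using fun_cong[OF app[OF v(1)], of t] v(2) c(3)[OF that] by (simp add: N_def)
  then show ?thesis by (intro exI[of _ "apply_bcontfun v"]) simp
qed

subsection \<open>Riemann-Liouville integrals\<close>

lemma rl_integral_cong: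
  "(\<And>s. s \<in> {0..t} \<Longrightarrow> u s = v s) \<Longrightarrow> 0 \<le> t \<Longrightarrow> rl_integral \<mu> u t = rl_integral \<mu> v t"
  unfolding rl_integral_def by (auto intro!: integral_cong)

text \<open>The substitution s = t r reduces the claim to the Beta integral on [0,1];
  \<open>t = 0\<close> is separate because the rescaling divides by \<open>t\<close>.\<close>

lemma has_integral_rl_powr:
  fixes a \<mu> t :: real
  assumes "0 < \<mu>" "0 \<le> a" "0 \<le> t"
  shows "((\<lambda>s. (t - s) powr (\<mu> - 1) * s powr a) has_integral Beta (a + 1) \<mu> * t powr (a + \<mu>)) {0..t}"
proof (cases "t = 0")
  case True
  then show ?thesis by auto
next
  case False
  then have t: "0 < t" using assms by simp
  have "((\<lambda>r. r powr a * (1 - r) powr (\<mu> - 1)) has_integral Beta (a + 1) \<mu>) {0..1}"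
    using has_integral_Beta_real[of "a + 1" \<mu>] assms by simp
  moreover have "(\<lambda>x. x / (1 / t)) ` {0..1} = {0..t}"
    using t image_divide_atLeastAtMost[of "1 / t" 0 1] by simp
  ultimately have "((\<lambda>s. (s / t) powr a * (1 - s / t) powr (\<mu> - 1)) has_integral t * Beta (a + 1) \<mu>) {0..t}"
    using t has_integral_stretch_real[of _ "Beta (a + 1) \<mu>" 0 1 "1 / t"] by fastforce
  from has_integral_mult_right[OF this, of "t powr (a + \<mu> - 1)"]
  have I: "((\<lambda>s. t powr (a + \<mu> - 1) * ((s / t) powr a * (1 - s / t) powr (\<mu> - 1)))
         has_integral Beta (a + 1) \<mu> * t powr (a + \<mu>)) {0..t}"
    using t by (simp add: powr_diff mult_ac)
  show ?thesis
  proof (rule has_integral_eq[OF _ I])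
    fix s assume "s \<in> {0..t}"
    then have s: "0 \<le> s" "0 \<le> t - s" by auto
    have "1 - s / t = (t - s) / t" using t by (simp add: field_simps)
    then have "(s / t) powr a * (1 - s / t) powr (\<mu> - 1)
          = (t - s) powr (\<mu> - 1) * s powr a / (t powr a * t powr (\<mu> - 1))"
      using s t by (simp add: powr_divide)
    also have "t powr a * t powr (\<mu> - 1) = t powr (a + \<mu> - 1)"
      by (simp add: add_diff_eq flip: powr_add)
    finally show "t powr (a + \<mu> - 1) * ((s / t) powr a * (1 - s / t) powr (\<mu> - 1))
        = (t - s) powr (\<mu> - 1) * s powr a" using t by simp
  qed
qed

lemma rl_integral_powr:
  fixes a \<mu> t :: real
  assumes "0 < \<mu>" "0 \<le> a" "0 \<le> t"
  shows "rl_integral \<mu> (\<lambda>s. s powr a) t = Gamma (a + 1) / Gamma (a + \<mu> + 1) * t powr (a + \<mu>)"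
proof -
  have "Gamma \<mu> \<noteq> 0" using Gamma_real_pos[OF assms(1)] by simp
  then show ?thesis
    using integral_unique[OF has_integral_rl_powr[OF assms]] assms(1)
    by (simp add: rl_integral_def Beta_def add_ac)
qed

lemma rl_integral_power:
  fixes \<mu> t :: real
  assumes "0 < \<mu>" "0 \<le> t"
  shows "rl_integral \<mu> (\<lambda>s. s ^ k) t = Gamma (real k + 1) / Gamma (k + \<mu> + 1) * t powr (k + \<mu>)"
proof -
  \<comment> \<open>For \<open>k = 0\<close> the integrands can differ at \<open>s = 0\<close>,
    because \<open>0 powr 0 = 0\<close> whereas \<open>0 ^ 0 = 1\<close>. A single point does not
    change the integral.\<close>
  have "integral {0..t} (\<lambda>s. (t - s) powr (\<mu> - 1) * s ^ k)
      = integral {0..t} (\<lambda>s. (t - s) powr (\<mu> - 1) * s powr k)"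
    by (rule integral_spike[of "{0}"]) (auto simp: powr_realpow)
  then show ?thesis
    using rl_integral_powr[OF assms(1) _ assms(2), of k] assms(1) by (simp add: rl_integral_def)
qed

lemma rl_kernel_has_integral:
  fixes \<mu> t :: real
  assumes "0 < \<mu>" "0 \<le> t"
  shows "((\<lambda>s. (t - s) powr (\<mu> - 1)) has_integral t powr \<mu> / \<mu>) {0..t}"
proof -
  have "Gamma (1 + \<mu>) = \<mu> * Gamma \<mu>"
    using Gamma_plus1[of \<mu>] assms(1) by (auto simp: add_ac nonpos_Ints_def)
  moreover have "Gamma \<mu> \<noteq> 0" using Gamma_real_pos[OF assms(1)] by linarith
  ultimately have B: "Beta 1 \<mu> = 1 / \<mu>" using assms(1) by (simp add: Beta_def)
  \<comment> \<open>Again \<open>s powr 0\<close> is 1 except at \<open>s = 0\<close>, which the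
    spike at that point repairs.\<close>
  have "((\<lambda>s. (t - s) powr (\<mu> - 1) * s powr 0) has_integral t powr \<mu> / \<mu>) {0..t}"
    using has_integral_rl_powr[of \<mu> 0 t] assms by (simp add: B)
  then show ?thesis
    by (rule has_integral_spike_finite[of "{0}", rotated 2]) auto
qed

text \<open>For \<open>\<mu> < 1\<close> the kernel is singular at \<open>s = t\<close>, but it is
  nonnegative with a finite integral, and \<open>u\<close> is bounded.\<close>

lemma absolutely_integrable_rl:
  fixes u :: "real \<Rightarrow> real"
  assumes "0 < \<mu>" "continuous_on {0..t} u" "0 \<le> t"
  shows "(\<lambda>s. (t - s) powr (\<mu> - 1) * u s) absolutely_integrable_on {0..t}"
proof -
  have "(\<lambda>s. u s * (t - s) powr (\<mu> - 1)) absolutely_integrable_on {0..t}"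
  proof (rule absolutely_integrable_bounded_measurable_product_real[of u _ "\<lambda>s. (t - s) powr (\<mu> - 1)"])
    show "u \<in> borel_measurable (lebesgue_on {0..t})"
      using assms(2) by (intro continuous_imp_measurable_on_sets_lebesgue) auto
    show "bounded (u ` {0..t})"
      using assms(2) by (intro compact_imp_bounded compact_continuous_image) auto
    show "(\<lambda>s. (t - s) powr (\<mu> - 1)) absolutely_integrable_on {0..t}"
      using rl_kernel_has_integral[of \<mu> t] assms
      by (intro nonnegative_absolutely_integrable_1) (auto simp: integrable_on_def)
  qed auto
  then show ?thesis by (simp add: mult.commute)
qed

lemma integrable_rl:
  fixes u :: "real \<Rightarrow> real"
  shows "0 < \<mu> \<Longrightarrow> continuous_on {0..t} u \<Longrightarrow> 0 \<le> t \<Longrightarrow> (\<lambda>s. (t - s) powr (\<mu> - 1) * u s) integrable_on {0..t}"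
  using absolutely_integrable_rl set_lebesgue_integral_eq_integral(1) by blast

lemma rl_integral_cmult: "rl_integral \<mu> (\<lambda>s. c * u s) t = c * rl_integral \<mu> u t"
  by (simp add: rl_integral_def mult.left_commute[of _ c])

lemma rl_integral_add:
  assumes "0 \<le> \<mu>" "continuous_on {0..t} u" "continuous_on {0..t} v" "0 \<le> t"
  shows "rl_integral \<mu> (\<lambda>s. u s + v s) t = rl_integral \<mu> u t + rl_integral \<mu> v t"
  using assms integrable_rl[of \<mu> t u] integrable_rl[of \<mu> t v]
  by (simp add: rl_integral_def distrib_left integral_add)

lemma rl_integral_diff:
  assumes "0 \<le> \<mu>" "continuous_on {0..t} u" "continuous_on {0..t} v" "0 \<le> t"
  shows "rl_integral \<mu> (\<lambda>s. u s - v s) t = rl_integral \<mu> u t - rl_integral \<mu> v t"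
  using assms integrable_rl[of \<mu> t u] integrable_rl[of \<mu> t v]
  by (simp add: rl_integral_def right_diff_distrib integral_diff)

lemma rl_integral_sum:
  assumes "0 \<le> \<mu>" "finite A" "\<And>i. i \<in> A \<Longrightarrow> continuous_on {0..t} (u i)" "0 \<le> t"
  shows "rl_integral \<mu> (\<lambda>s. \<Sum>i\<in>A. u i s) t = (\<Sum>i\<in>A. rl_integral \<mu> (u i) t)"
  using assms(2,3)
proof (induction A rule: finite_induct)
  case empty
  then show ?case by (simp add: rl_integral_def)
next
  case (insert i A)
  then show ?case
    using rl_integral_add[of \<mu> t "u i" "\<lambda>s. \<Sum>i\<in>A. u i s"] assms(1,4)
    by (simp add: continuous_on_sum)
qed

text \<open>The integral of the constant \<open>C\<close> dominates. Every power-over-Gamma quotient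
  in \<open>\<Theta>\<close> arises from an instance of this bound.\<close>

lemma rl_integral_bound:
  assumes "0 < \<mu>" "continuous_on {0..t} u" "0 \<le> t" "\<And>s. s \<in> {0..t} \<Longrightarrow> \<bar>u s\<bar> \<le> C"
  shows "\<bar>rl_integral \<mu> u t\<bar> \<le> C * (t powr \<mu> / Gamma (\<mu> + 1))"
proof -
  have I: "((\<lambda>s. (t - s) powr (\<mu> - 1) * C) has_integral t powr \<mu> / \<mu> * C) {0..t}"
    using rl_kernel_has_integral[OF assms(1,3)] by (rule has_integral_mult_left)
  have "norm (integral {0..t} (\<lambda>s. (t - s) powr (\<mu> - 1) * u s))
      \<le> integral {0..t} (\<lambda>s. (t - s) powr (\<mu> - 1) * C)"
    using assms I by (intro integral_norm_bound_integral integrable_rl)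
      (auto simp: abs_mult intro!: mult_left_mono has_integral_integrable)
  also have "\<dots> = C * (t powr \<mu> / \<mu>)" using integral_unique[OF I] by simp
  finally have "\<bar>integral {0..t} (\<lambda>s. (t - s) powr (\<mu> - 1) * u s)\<bar> \<le> C * (t powr \<mu> / \<mu>)" by simp
  moreover have "Gamma (\<mu> + 1) = \<mu> * Gamma \<mu>"
    using Gamma_plus1[of \<mu>] assms(1) by (auto simp: nonpos_Ints_def)
  moreover have "0 < Gamma \<mu>" "Gamma \<mu> \<noteq> 0" using Gamma_real_pos[OF assms(1)] by linarith+
  ultimately show ?thesis
    using assms(1) by (simp add: rl_integral_def abs_mult field_simps)
qed

lemma rl_integral_polynomial:
  fixes a :: "nat \<Rightarrow> real"
  assumes "0 < \<mu>" "0 \<le> t"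
  shows "rl_integral \<mu> (\<lambda>s. \<Sum>i\<le>n. a i * s ^ i) t
     = (\<Sum>i\<le>n. a i * (Gamma (real i + 1) / Gamma (i + \<mu> + 1)) * t powr (i + \<mu>))"
  using assms by (subst rl_integral_sum)
    (auto simp: rl_integral_cmult rl_integral_power mult.assoc intro!: continuous_intros)

lemma polynomial_approximation_01:
  fixes u :: "real \<Rightarrow> real"
  assumes "continuous_on {0..1} u" "0 < e"
  obtains a n where "\<And>s. s \<in> {0..1} \<Longrightarrow> \<bar>u s - (\<Sum>i\<le>(n::nat). a i * s ^ i)\<bar> < e"
  using Stone_Weierstrass_real_polynomial_function[OF compact_Icc assms]
  unfolding real_polynomial_function_iff_sum by metis

text \<open>By \<open>rl_integral_bound\<close> the operator is bounded in the sup norm, so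
  polynomial approximations of \<open>u\<close> give a uniform limit. The image of a polynomial is a
  finite sum of powers with positive exponents, hence continuous.\<close>

lemma continuous_on_rl_integral:
  assumes \<mu>: "0 \<le> \<mu>" and u: "continuous_on {0..1} u"
  shows "continuous_on {0..1} (rl_integral \<mu> u)"
proof (cases "\<mu> = 0")
  case True
  then show ?thesis using u by (simp add: rl_integral_def)
next
  case False
  then have \<mu>: "0 < \<mu>" using \<mu> by simp
  then have G: "0 < Gamma (\<mu> + 1)" by (intro Gamma_real_pos) simp
  have "\<forall>k. \<exists>a n. \<forall>s\<in>{0..1}. \<bar>u s - (\<Sum>i\<le>n. a i * s ^ i)\<bar> < 1 / Suc k"
    by (metis polynomial_approximation_01[OF u] of_nat_0_less_iff zero_less_Suc zero_less_divide_1_iff)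
  then obtain a n where an: "\<And>k s. s \<in> {0..1} \<Longrightarrow> \<bar>u s - (\<Sum>i\<le>n k. a k i * s ^ i)\<bar> < 1 / Suc k"
    by metis
  let ?P = "\<lambda>k s. \<Sum>i\<le>n k. a k i * s ^ i"
  have "uniform_limit {0..1} (\<lambda>k. rl_integral \<mu> (?P k)) (rl_integral \<mu> u) sequentially"
  proof (rule uniform_limitI)
    fix e :: real assume "0 < e"
    then obtain k0 where k0: "1 / real (Suc k0) < e * Gamma (\<mu> + 1)"
      using G nat_approx_posE[of "e * Gamma (\<mu> + 1)"] by auto
    show "\<forall>\<^sub>F k in sequentially. \<forall>t\<in>{0..1}. dist (rl_integral \<mu> (?P k) t) (rl_integral \<mu> u t) < e"
      unfolding eventually_sequentially
    proof (intro exI allI impI ballI)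
      fix k :: nat and t :: real assume "k0 \<le> k" and t: "t \<in> {0..1}"
      have c: "continuous_on {0..t} u" "continuous_on {0..t} (?P k)"
        using t by (auto intro!: continuous_intros continuous_on_subset[OF u])
      have "\<bar>rl_integral \<mu> (\<lambda>s. ?P k s - u s) t\<bar> \<le> 1 / Suc k * (t powr \<mu> / Gamma (\<mu> + 1))"
        using t an[of _ k] \<mu> c by (intro rl_integral_bound continuous_on_diff)
          (auto simp: abs_minus_commute less_imp_le)
      also have "\<dots> \<le> 1 / Suc k0 * (1 / Gamma (\<mu> + 1))"
        using t \<mu> G \<open>k0 \<le> k\<close> by (intro mult_mono divide_right_mono divide_left_mono powr_le1) auto
      also have "\<dots> < e"
        using k0 G pos_divide_less_eq[of "Gamma (\<mu> + 1)" "1 / real (Suc k0)" e] by simp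
      finally show "dist (rl_integral \<mu> (?P k) t) (rl_integral \<mu> u t) < e"
        using rl_integral_diff[of \<mu> t "?P k" u] \<mu> c t by (simp add: dist_real_def)
    qed
  qed
  moreover have "continuous_on {0..1} (rl_integral \<mu> (?P k))" for k
  proof (subst continuous_on_cong[OF refl rl_integral_polynomial[OF \<mu>]])
    show "continuous_on {0..1} (\<lambda>t. \<Sum>i\<le>n k. a k i * (Gamma (real i + 1) / Gamma (i + \<mu> + 1)) * t powr (i + \<mu>))"
      using \<mu> by (intro continuous_intros continuous_on_powr') auto
  qed auto
  ultimately show ?thesis
    by (intro uniform_limit_theorem[where F = sequentially]) auto
qed

text \<open>On monomials the intermediate factor \<open>Gamma (i + \<nu> + 1)\<close> cancels. Since
  both sides are bounded operators, the identity passes to uniform limits, with no exchange of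
  singular integrals.\<close>

lemma rl_integral_semigroup:
  assumes \<mu>: "0 < \<mu>" and \<nu>: "0 < \<nu>" and u: "continuous_on {0..1} u" and t: "t \<in> {0..1}"
  shows "rl_integral \<mu> (rl_integral \<nu> u) t = rl_integral (\<mu> + \<nu>) u t"
proof -
  have t0: "0 \<le> t" using t by simp
  have G: "0 < Gamma (\<mu> + 1)" "0 < Gamma (\<nu> + 1)" "0 < Gamma (\<mu> + \<nu> + 1)"
    using \<mu> \<nu> by (auto intro: Gamma_real_pos)
  \<comment> \<open>\<open>B\<close> adds the operator bounds of the two sides: replacing
    \<open>u\<close> by a polynomial within \<open>d\<close> costs at most \<open>d * B\<close> in
    total.\<close>
  define B where "B = 1 / Gamma (\<nu> + 1) * (1 / Gamma (\<mu> + 1)) + 1 / Gamma (\<mu> + \<nu> + 1)"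
  have B: "0 < B" using G by (simp add: B_def add_pos_pos)
  have "\<bar>rl_integral \<mu> (rl_integral \<nu> u) t - rl_integral (\<mu> + \<nu>) u t\<bar> \<le> 0 + e" if "0 < e" for e
  proof -
    define d where "d = e / B"
    have d: "0 < d" using that B by (simp add: d_def)
    obtain a n where an: "\<And>s. s \<in> {0..1} \<Longrightarrow> \<bar>u s - (\<Sum>i\<le>(n::nat). a i * s ^ i)\<bar> < d"
      using polynomial_approximation_01[OF u d] by blast
    let ?P = "\<lambda>s. \<Sum>i\<le>n. a i * s ^ i"
    have P: "continuous_on A ?P" for A by (intro continuous_intros)
    have c: "continuous_on {0..s} u" "continuous_on {0..s} (rl_integral \<nu> u)"
      "continuous_on {0..s} (rl_integral \<nu> ?P)" if "s \<in> {0..1}" for s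
      using that \<nu> by (auto intro: continuous_on_subset[OF u]
          continuous_on_subset[OF continuous_on_rl_integral[OF _ u]]
          continuous_on_subset[OF continuous_on_rl_integral[OF _ P]])
    have bound: "\<bar>rl_integral \<rho> u s - rl_integral \<rho> ?P s\<bar> \<le> d * (1 / Gamma (\<rho> + 1))"
      if "0 < \<rho>" "s \<in> {0..1}" for \<rho> s
    proof -
      have "\<bar>rl_integral \<rho> (\<lambda>s. u s - ?P s) s\<bar> \<le> d * (s powr \<rho> / Gamma (\<rho> + 1))"
        using that an c P by (intro rl_integral_bound continuous_on_diff) (auto simp: less_imp_le)
      also have "\<dots> \<le> d * (1 / Gamma (\<rho> + 1))"
        using that d by (intro mult_left_mono divide_right_mono powr_le1) (auto intro!: less_imp_le Gamma_real_pos)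
      finally show ?thesis using rl_integral_diff[of \<rho> s u ?P] that c P by simp
    qed
    define b where "b = (\<lambda>i. a i * (Gamma (real i + 1) / Gamma (i + \<nu> + 1)))"
    have "rl_integral \<mu> (rl_integral \<nu> ?P) t = rl_integral \<mu> (\<lambda>s. \<Sum>i\<le>n. b i * s powr (i + \<nu>)) t"
      unfolding b_def using \<nu> t0 by (intro rl_integral_cong) (rule rl_integral_polynomial, auto)
    also have "\<dots> = (\<Sum>i\<le>n. b i *
          (Gamma (i + \<nu> + 1) / Gamma (i + \<nu> + \<mu> + 1) * t powr (i + \<nu> + \<mu>)))"
      using \<mu> \<nu> t0 by (subst rl_integral_sum)
        (auto simp: rl_integral_cmult rl_integral_powr intro!: continuous_intros continuous_on_powr')
    also have "\<dots> = rl_integral (\<mu> + \<nu>) ?P t"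
    proof (subst rl_integral_polynomial, goal_cases)
      case 3
      have "0 < Gamma (i + \<nu> + 1)" for i :: nat using \<nu> by (intro Gamma_real_pos) simp
      then have "Gamma (i + \<nu> + 1) \<noteq> 0" for i :: nat by (metis less_irrefl)
      then show ?case by (intro sum.cong) (auto simp: b_def add_ac)
    qed (use \<mu> \<nu> t0 in auto)
    finally have semi: "rl_integral \<mu> (rl_integral \<nu> ?P) t = rl_integral (\<mu> + \<nu>) ?P t" .
    have "\<bar>rl_integral \<mu> (\<lambda>s. rl_integral \<nu> u s - rl_integral \<nu> ?P s) t\<bar>
        \<le> d * (1 / Gamma (\<nu> + 1)) * (t powr \<mu> / Gamma (\<mu> + 1))"
      using bound[OF \<nu>] t \<mu> c by (intro rl_integral_bound continuous_on_diff) auto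
    also have "\<dots> \<le> d * (1 / Gamma (\<nu> + 1)) * (1 / Gamma (\<mu> + 1))"
      using t d G \<mu> by (intro mult_left_mono divide_right_mono powr_le1) auto
    finally have "\<bar>rl_integral \<mu> (rl_integral \<nu> u) t - rl_integral \<mu> (rl_integral \<nu> ?P) t\<bar>
        \<le> d * (1 / Gamma (\<nu> + 1)) * (1 / Gamma (\<mu> + 1))"
      using \<mu> c[OF t] t0 by (subst rl_integral_diff[symmetric]) auto
    then have "\<bar>rl_integral \<mu> (rl_integral \<nu> u) t - rl_integral (\<mu> + \<nu>) u t\<bar> \<le> d * B"
      using bound[of "\<mu> + \<nu>" t] \<mu> \<nu> t unfolding semi B_def by (simp add: algebra_simps)
    then show ?thesis using B by (simp add: d_def)
  qed
  then have "\<bar>rl_integral \<mu> (rl_integral \<nu> u) t - rl_integral (\<mu> + \<nu>) u t\<bar> \<le> 0"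
    by (rule field_le_epsilon)
  then show ?thesis by simp
qed

text \<open>Order 1 is ordinary integration up to one point: as \<open>0 powr 0 = 0\<close>, the
  kernel vanishes at \<open>s = t\<close> instead of being 1.\<close>

lemma rl_integral_1: "0 \<le> t \<Longrightarrow> rl_integral 1 u t = integral {0..t} u"
  by (auto simp: rl_integral_def split: if_splits intro!: integral_spike[of "{t}"])

text \<open>The semigroup law writes the integral of order \<open>1 + \<mu>\<close> as an ordinary
  integral of the one of order \<open>\<mu>\<close>, to which the fundamental theorem of calculus
  applies. Order 0 is the identity and is treated separately, the semigroup law being for positive
  orders.\<close>

lemma rl_integral_Suc_has_vector_derivative:
  assumes "0 \<le> \<mu>" and u: "continuous_on {0..1} u" and t: "t \<in> {0..1}"
  shows "(rl_integral (1 + \<mu>) u has_vector_derivative rl_integral \<mu> u t) (at t within {0..1})"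
proof -
  have v: "continuous_on {0..1} (rl_integral \<mu> u)" using assms by (intro continuous_on_rl_integral)
  have eq: "rl_integral (1 + \<mu>) u s = integral {0..s} (rl_integral \<mu> u)" if "s \<in> {0..1}" for s
  proof (cases "\<mu> = 0")
    case True
    moreover have "rl_integral 0 u = u" by (simp add: rl_integral_def fun_eq_iff)
    ultimately show ?thesis using that by (simp add: rl_integral_1)
  next
    case False
    then show ?thesis
      using rl_integral_semigroup[of 1 \<mu> u s] assms(1) u that by (simp add: rl_integral_1)
  qed
  show ?thesis
    by (rule has_vector_derivative_transform[OF t _ integral_has_vector_derivative[OF v t]])
      (simp add: eq)
qed

subsection \<open>The linear Caputo problem\<close>

lemma deriv01_eq:
  "(x has_vector_derivative D) (at t within {0..1}) \<Longrightarrow> t \<in> {0..1} \<Longrightarrow> deriv01 x t = D"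
  unfolding deriv01_def by (rule vector_derivative_within_closed_interval) auto

lemma C1_01I:
  assumes "\<And>t. t \<in> {0..1} \<Longrightarrow> (x has_vector_derivative y t) (at t within {0..1})"
    and "continuous_on {0..1} y"
  shows "C1_01 x"
  unfolding C1_01_def
proof
  show "\<forall>t\<in>{0..1}. x differentiable (at t within {0..1})"
    using assms(1)[THEN differentiableI_vector] by blast
  show "continuous_on {0..1} (deriv01 x)"
    using assms(2) by (rule continuous_on_eq) (simp add: deriv01_eq[OF assms(1)])
qed

lemma rl_integral_const: "0 < \<mu> \<Longrightarrow> 0 \<le> t \<Longrightarrow> rl_integral \<mu> (\<lambda>_. b) t = b * (t powr \<mu> / Gamma (\<mu> + 1))"
  using rl_integral_power[of \<mu> t 0] rl_integral_cmult[of \<mu> b "\<lambda>_. 1" t] by (simp add: add_ac)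

text \<open>The common shape of all solutions of the linear equation is studied with
  \<open>a\<close> and \<open>b\<close> arbitrary; the boundary conditions select them later. The
  form is prescribed on [0,1] only, so it suits a fixed point with any values outside.\<close>

context
  fixes q a b :: real and h x :: "real \<Rightarrow> real"
  assumes q: "1 < q" "q \<le> 2" and h: "continuous_on {0..1} h"
    and x: "\<And>t. t \<in> {0..1} \<Longrightarrow> x t = rl_integral q h t + a + b * t"
begin

lemma rl_affine_has_vector_derivative:
  assumes t: "t \<in> {0..1}"
  shows "(x has_vector_derivative rl_integral (q - 1) h t + b) (at t within {0..1})"
proof -
  have "(rl_integral q h has_vector_derivative rl_integral (q - 1) h t) (at t within {0..1})"
    using rl_integral_Suc_has_vector_derivative[of "q - 1" h t] q h t by simp
  then have "((\<lambda>t. rl_integral q h t + a + b * t) has_vector_derivative rl_integral (q - 1) h t + b)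
      (at t within {0..1})"
    by (auto intro!: derivative_eq_intros)
  then show ?thesis
    by (rule has_vector_derivative_transform[OF t, rotated]) (simp add: x)
qed

lemma rl_affine_C1_01: "C1_01 x"
  using q by (intro C1_01I[OF rl_affine_has_vector_derivative] continuous_intros continuous_on_rl_integral h) auto

lemma rl_affine_deriv01: "t \<in> {0..1} \<Longrightarrow> deriv01 x t = rl_integral (q - 1) h t + b"
  by (intro deriv01_eq rl_affine_has_vector_derivative)

text \<open>Integrals of positive order vanish at 0, and \<open>q > 1\<close>, so \<open>a\<close>
  and \<open>b\<close> are the Taylor coefficients that \<open>caputo_aux\<close> subtracts. What
  remains has order \<open>(2 - q) + q = 2\<close>; for \<open>q = 2\<close> the outer integral is
  the identity.\<close>

lemma rl_affine_caputo_aux: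
  assumes t: "t \<in> {0..1}"
  shows "caputo_aux q x t = rl_integral 2 h t"
proof -
  have "deriv01 x 0 = b" "x 0 = a"
    using q by (simp_all add: rl_affine_deriv01 x rl_integral_def)
  then have "caputo_aux q x t = rl_integral (2 - q) (rl_integral q h) t"
    unfolding caputo_aux_def using t by (intro rl_integral_cong) (auto simp: x)
  also have "\<dots> = rl_integral 2 h t"
  proof (cases "q = 2")
    case False
    then show ?thesis using rl_integral_semigroup[of "2 - q" q h t] q h t by simp
  qed (simp add: rl_integral_def)
  finally show ?thesis .
qed

lemma rl_affine_caputo_aux_has_vector_derivative:
  assumes t: "t \<in> {0..1}"
  shows "(caputo_aux q x has_vector_derivative rl_integral 1 h t) (at t within {0..1})"
  using rl_integral_Suc_has_vector_derivative[of 1 h t] h t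
  by (intro has_vector_derivative_transform[OF t, of "caputo_aux q x" "rl_integral 2 h"])
    (simp_all add: rl_affine_caputo_aux)

lemma rl_affine_deriv01_caputo_aux_has_vector_derivative:
  assumes t: "t \<in> {0..1}"
  shows "(deriv01 (caputo_aux q x) has_vector_derivative h t) (at t within {0..1})"
proof (rule has_vector_derivative_transform[OF t])
  show "(rl_integral 1 h has_vector_derivative h t) (at t within {0..1})"
    using rl_integral_Suc_has_vector_derivative[of 0 h t] h t by (simp add: rl_integral_def)
qed (simp add: deriv01_eq[OF rl_affine_caputo_aux_has_vector_derivative])

lemma rl_affine_caputo_differentiable: "caputo_differentiable q x"
  unfolding caputo_differentiable_def C2_01_def
  by (intro conjI impI rl_affine_C1_01 C1_01I[OF rl_affine_caputo_aux_has_vector_derivative]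
      C1_01I[OF rl_affine_deriv01_caputo_aux_has_vector_derivative] continuous_on_rl_integral h) auto

lemma rl_affine_caputo: "t \<in> {0..1} \<Longrightarrow> caputo q x t = h t"
  using q by (simp add: caputo_def deriv01_eq[OF rl_affine_deriv01_caputo_aux_has_vector_derivative])

text \<open>The orders \<open>1 - \<sigma>\<close> and \<open>q - 1\<close> add up to
  \<open>q - \<sigma>\<close>. The point 0 is excluded because for \<open>\<sigma> = 1\<close> the
  factor \<open>t powr 0\<close> would be 0 there and lose the summand \<open>b\<close>.\<close>

lemma rl_affine_caputo_le_1:
  assumes \<sigma>: "0 < \<sigma>" "\<sigma> \<le> 1" and t: "t \<in> {0<..1}"
  shows "caputo \<sigma> x t = rl_integral (q - \<sigma>) h t + b * (t powr (1 - \<sigma>) / Gamma (2 - \<sigma>))"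
proof -
  have c: "continuous_on {0..t} (rl_integral (q - 1) h)"
    using q t by (intro continuous_on_subset[OF continuous_on_rl_integral[OF _ h]]) auto
  have "caputo \<sigma> x t = rl_integral (1 - \<sigma>) (\<lambda>s. rl_integral (q - 1) h s + b) t"
    unfolding caputo_def using \<sigma> t by (auto intro!: rl_integral_cong simp: rl_affine_deriv01)
  also have "\<dots> = rl_integral (1 - \<sigma>) (rl_integral (q - 1) h) t + rl_integral (1 - \<sigma>) (\<lambda>_. b) t"
    using \<sigma> t c by (intro rl_integral_add) auto
  also have "\<dots> = rl_integral (q - \<sigma>) h t + b * (t powr (1 - \<sigma>) / Gamma (2 - \<sigma>))"
  proof (cases "\<sigma> = 1")
    case True
    then show ?thesis using t by (simp add: rl_integral_def)
  next
    case False
    then show ?thesis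
      using \<sigma> q t h rl_integral_semigroup[of "1 - \<sigma>" "q - 1" h t] by (simp add: rl_integral_const)
  qed
  finally show ?thesis .
qed

lemma rl_affine_integral:
  assumes t: "t \<in> {0..1}"
  shows "integral {0..t} x = rl_integral (q + 1) h t + a * t + b * t\<^sup>2 / 2"
proof -
  have c: "continuous_on {0..t} (rl_integral q h)"
    using q t by (intro continuous_on_subset[OF continuous_on_rl_integral[OF _ h]]) auto
  have "integral {0..t} x = integral {0..t} (\<lambda>s. rl_integral q h s + a + b * s)"
    using t by (intro integral_cong) (simp add: x)
  also have "\<dots> = integral {0..t} (rl_integral q h) + a * t + b * (t\<^sup>2 / 2)"
    using c t integral_unique[OF ident_has_integral[of 0 t]]
    by (simp add: integral_add integrable_continuous_interval continuous_intros)
  also have "integral {0..t} (rl_integral q h) = rl_integral (q + 1) h t"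
    using rl_integral_semigroup[of 1 q h t] q h t by (simp add: rl_integral_1 add.commute)
  finally show ?thesis by simp
qed

end

text \<open>For \<open>q > 1\<close> the derivative is an integral of positive order
  \<open>q - 1\<close>, bounded by \<open>C / Gamma q\<close>. This supplies the equicontinuity
  behind the compact image.\<close>

lemma rl_integral_lipschitz:
  assumes q: "1 < q" and h: "continuous_on {0..1} h" and C: "\<And>s. s \<in> {0..1} \<Longrightarrow> \<bar>h s\<bar> \<le> C"
    and s: "s \<in> {0..1}" and t: "t \<in> {0..1}"
  shows "\<bar>rl_integral q h t - rl_integral q h s\<bar> \<le> C / Gamma q * \<bar>t - s\<bar>"
proof -
  have G: "0 < Gamma q" using q by (intro Gamma_real_pos) simp
  have C0: "0 \<le> C" using C[of 0] by simp
  have "norm (rl_integral q h t - rl_integral q h s) \<le> C / Gamma q * norm (t - s)"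
  proof (rule field_differentiable_bound[OF _ _ _ t s])
    show "convex {0..1::real}" by simp
    fix r :: real assume r: "r \<in> {0..1}"
    show "(rl_integral q h has_field_derivative rl_integral (q - 1) h r) (at r within {0..1})"
      using rl_integral_Suc_has_vector_derivative[of "q - 1" h r] q h r
      by (simp add: has_real_derivative_iff_has_vector_derivative)
    have "\<bar>rl_integral (q - 1) h r\<bar> \<le> C * (r powr (q - 1) / Gamma (q - 1 + 1))"
      using q r C by (intro rl_integral_bound continuous_on_subset[OF h]) auto
    also have "\<dots> \<le> C * (1 / Gamma q)"
      using q r G C0 by (intro mult_left_mono) (auto intro!: divide_right_mono powr_le1)
    finally show "norm (rl_integral (q - 1) h r) \<le> C / Gamma q" by simp
  qed
  then show ?thesis by simp
qed

subsection \<open>The nonlinear problem\<close>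

theorem theorem3p6:
  fixes q \<sigma> \<nu> \<xi> M \<Delta>\<^sub>1 \<Delta>\<^sub>2 \<Delta>\<^sub>3 \<Theta> :: real
    and n :: nat
    and \<eta> \<alpha> \<beta> \<gamma> :: "nat \<Rightarrow> real"
    and f :: "real \<Rightarrow> real \<Rightarrow> real"
    and p \<psi> :: "real \<Rightarrow> real"
  assumes "1 < q" "q \<le> 2"
    and "0 < \<sigma>" "\<sigma> \<le> 1"
    and "0 < \<nu>" "\<nu> \<le> 1"
    and "1 \<le> n"
    and "0 < \<xi>" "\<xi> < \<eta> 1" "strict_mono_on {1..n} \<eta>" "\<eta> n < 1"
    and "\<Delta>\<^sub>1 = \<xi> powr (1 - \<sigma>) * Gamma (2 - \<nu>)
               - Gamma (2 - \<sigma>) * (\<Sum>i=1..n. \<alpha> i * \<eta> i powr (1 - \<nu>))"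
    and "\<Delta>\<^sub>2 = 1 - (\<Sum>i=1..n. \<beta> i * \<eta> i + \<gamma> i)"
    and "\<Delta>\<^sub>3 = - 2 + (\<Sum>i=1..n. \<eta> i * (\<beta> i * \<eta> i + 2 * \<gamma> i))"
    and "\<Delta>\<^sub>1 \<noteq> 0" "\<Delta>\<^sub>2 \<noteq> 0"
    and "\<Theta> = 1 / Gamma (q + 1)
             + 1 / (\<bar>\<Delta>\<^sub>2\<bar> * Gamma (q + 2))
               * (1 + q + (\<Sum>i=1..n. \<eta> i powr q * (\<eta> i * \<bar>\<beta> i\<bar> + (q + 1) * \<bar>\<gamma> i\<bar>)))
             + Gamma (2 - \<sigma>) * Gamma (2 - \<nu>) * (\<bar>\<Delta>\<^sub>3\<bar> + 2 * \<bar>\<Delta>\<^sub>2\<bar>) / (2 * \<bar>\<Delta>\<^sub>1 * \<Delta>\<^sub>2\<bar>)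
               * (\<xi> powr (q - \<sigma>) / Gamma (q - \<sigma> + 1)
                  + (\<Sum>i=1..n. \<bar>\<alpha> i\<bar> * (\<eta> i powr (q - \<nu>) / Gamma (q - \<nu> + 1))))"
    and "continuous_on ({0..1} \<times> UNIV) (\<lambda>(t, x). f t x)"
    and "continuous_on {0..1} p" "\<And>t. t \<in> {0..1} \<Longrightarrow> 0 \<le> p t"
    and "mono_on {0..} \<psi>" "\<And>r. 0 \<le> r \<Longrightarrow> 0 \<le> \<psi> r"
    and "\<And>t x. t \<in> {0..1} \<Longrightarrow> \<bar>f t x\<bar> \<le> p t * \<psi> \<bar>x\<bar>"
    and "0 < M"
    and "M / (\<Theta> * \<psi> M * (SUP t\<in>{0..1}. \<bar>p t\<bar>)) > 1"
  shows "\<exists>x :: real \<Rightarrow> real.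
           C1_01 x \<and> caputo_differentiable q x
         \<and> (\<forall>t\<in>{0..1}. caputo q x t = f t (x t))
         \<and> caputo \<sigma> x \<xi> = (\<Sum>i=1..n. \<alpha> i * caputo \<nu> x (\<eta> i))
         \<and> x 1 = (\<Sum>i=1..n. \<beta> i * integral {0..\<eta> i} x) + (\<Sum>i=1..n. \<gamma> i * x (\<eta> i))"
proof -

  \<comment> \<open>Location of the nodes and values of Gamma\<close>
  note q = \<open>1 < q\<close> \<open>q \<le> 2\<close> and \<sigma> = \<open>0 < \<sigma>\<close> \<open>\<sigma> \<le> 1\<close> and \<nu> = \<open>0 < \<nu>\<close> \<open>\<nu> \<le> 1\<close>
  have \<xi>: "\<xi> \<in> {0<..1}" and \<eta>: "\<And>i. i \<in> {1..n} \<Longrightarrow> \<eta> i \<in> {0<..1}"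
  proof -
    have "\<eta> 1 \<le> \<eta> i" "\<eta> i \<le> \<eta> n" if "i \<in> {1..n}" for i
      using strict_mono_on_imp_mono_on[OF assms(10)] that by (auto simp: mono_on_def)
    with \<open>0 < \<xi>\<close> \<open>\<xi> < \<eta> 1\<close> \<open>\<eta> n < 1\<close> \<open>1 \<le> n\<close>
    show "\<xi> \<in> {0<..1}" "\<And>i. i \<in> {1..n} \<Longrightarrow> \<eta> i \<in> {0<..1}" by force+
  qed
  have G: "0 < Gamma (2 - \<sigma>)" "0 < Gamma (2 - \<nu>)" "0 < Gamma (q + 1)" "0 < Gamma (q + 2)"
      "0 < Gamma (q - \<sigma> + 1)" "0 < Gamma (q - \<nu> + 1)"
    using q \<sigma> \<nu> by (auto intro!: Gamma_real_pos)
  \<comment> \<open>Bringing bounds with denominator \<open>Gamma (q + 1)\<close> over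
    \<open>Gamma (q + 2)\<close> produces the factors \<open>1 + q\<close> and \<open>q + 1\<close>
    in \<open>\<Theta>\<close>.\<close>
  have Gq2: "Gamma (q + 2) = (q + 1) * Gamma (q + 1)"
    using Gamma_plus1[of "q + 1"] q by (auto simp: nonpos_Ints_def add_ac)

  \<comment> \<open>The solution operator of the linear problem and its constants\<close>
  define b where "b = (\<lambda>h. Gamma (2 - \<sigma>) * Gamma (2 - \<nu>) / \<Delta>\<^sub>1 *
      ((\<Sum>i=1..n. \<alpha> i * rl_integral (q - \<nu>) h (\<eta> i)) - rl_integral (q - \<sigma>) h \<xi>))"
  \<comment> \<open>In the first boundary condition \<open>b\<close> has the coefficient
    \<open>\<Delta>\<^sub>1 / (Gamma (2 - \<sigma>) * Gamma (2 - \<nu>))\<close>. In the second,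
    collected on one side, \<open>a\<close> has the coefficient \<open>\<Delta>\<^sub>2\<close> and
    \<open>b\<close> contributes \<open>b h * \<Delta>\<^sub>3 / 2\<close> on the other.\<close>
  define a where "a = (\<lambda>h. ((\<Sum>i=1..n. \<beta> i * rl_integral (q + 1) h (\<eta> i) + \<gamma> i * rl_integral q h (\<eta> i))
      - rl_integral q h 1 + b h * \<Delta>\<^sub>3 / 2) / \<Delta>\<^sub>2)"
  define S where "S = (\<lambda>h t. rl_integral q h t + a h + b h * t)"
  \<comment> \<open>For \<open>h\<close> bounded by 1, \<open>W\<close> bounds the bracket in
    \<open>b\<close>, \<open>B\<close> bounds \<open>b h\<close>, and \<open>A\<close> bounds the
    part of \<open>a h\<close> not coming from \<open>b\<close>. The number \<open>m\<close> will
    bound \<open>f t x\<close> for \<open>x\<close> of modulus at most \<open>M\<close>.\<close>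
  define W where "W = \<xi> powr (q - \<sigma>) / Gamma (q - \<sigma> + 1)
      + (\<Sum>i=1..n. \<bar>\<alpha> i\<bar> * (\<eta> i powr (q - \<nu>) / Gamma (q - \<nu> + 1)))"
  define B where "B = Gamma (2 - \<sigma>) * Gamma (2 - \<nu>) / \<bar>\<Delta>\<^sub>1\<bar> * W"
  define A where "A = 1 / (\<bar>\<Delta>\<^sub>2\<bar> * Gamma (q + 2))
      * (1 + q + (\<Sum>i=1..n. \<eta> i powr q * (\<eta> i * \<bar>\<beta> i\<bar> + (q + 1) * \<bar>\<gamma> i\<bar>)))"
  define m where "m = (SUP t\<in>{0..1}. \<bar>p t\<bar>) * \<psi> M"
  \<comment> \<open>The three summands bound the integral of order \<open>q\<close>, the constant
    \<open>a h\<close> and the slope \<open>b h\<close>; the factor with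
    \<open>\<bar>\<Delta>\<^sub>3\<bar> + 2 * \<bar>\<Delta>\<^sub>2\<bar>\<close> splits between
    the last two.\<close>
  have \<Theta>: "\<Theta> = 1 / Gamma (q + 1) + (A + B * \<bar>\<Delta>\<^sub>3\<bar> / (2 * \<bar>\<Delta>\<^sub>2\<bar>)) + B"
    unfolding assms(17) A_def B_def W_def using \<open>\<Delta>\<^sub>1 \<noteq> 0\<close> \<open>\<Delta>\<^sub>2 \<noteq> 0\<close>
    by (simp add: field_simps abs_mult)

  \<comment> \<open>Bounds for the coefficients of the solution operator\<close>
  have rlb: "\<bar>rl_integral \<mu> h t\<bar> \<le> C * (t powr \<mu> / Gamma (\<mu> + 1))"
    if "continuous_on {0..1} h" "\<And>s. s \<in> {0..1} \<Longrightarrow> \<bar>h s\<bar> \<le> C" "0 < \<mu>" "t \<in> {0..1}" for \<mu> h t C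
    using that by (intro rl_integral_bound continuous_on_subset[OF that(1)]) auto
  have bb: "\<bar>b h\<bar> \<le> B * C"
    if h: "continuous_on {0..1} h" and C: "\<And>s. s \<in> {0..1} \<Longrightarrow> \<bar>h s\<bar> \<le> C" for h C
  proof -
    have "\<bar>\<Sum>i=1..n. \<alpha> i * rl_integral (q - \<nu>) h (\<eta> i)\<bar>
        \<le> (\<Sum>i=1..n. \<bar>\<alpha> i\<bar> * (C * (\<eta> i powr (q - \<nu>) / Gamma (q - \<nu> + 1))))"
    proof (intro order_trans[OF sum_abs] sum_mono)
      fix i assume i: "i \<in> {1..n}"
      show "\<bar>\<alpha> i * rl_integral (q - \<nu>) h (\<eta> i)\<bar> \<le> \<bar>\<alpha> i\<bar> * (C * (\<eta> i powr (q - \<nu>) / Gamma (q - \<nu> + 1)))"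
        unfolding abs_mult using \<eta>[OF i] q \<nu> by (intro mult_left_mono rlb h C) auto
    qed
    also have "\<dots> = C * (\<Sum>i=1..n. \<bar>\<alpha> i\<bar> * (\<eta> i powr (q - \<nu>) / Gamma (q - \<nu> + 1)))"
      by (simp add: sum_distrib_left mult_ac)
    moreover have "W * C = C * (\<xi> powr (q - \<sigma>) / Gamma (q - \<sigma> + 1))
        + C * (\<Sum>i=1..n. \<bar>\<alpha> i\<bar> * (\<eta> i powr (q - \<nu>) / Gamma (q - \<nu> + 1)))"
      unfolding W_def by (rule trans[OF mult.commute distrib_left])
    moreover have "\<bar>rl_integral (q - \<sigma>) h \<xi>\<bar> \<le> C * (\<xi> powr (q - \<sigma>) / Gamma (q - \<sigma> + 1))"
      using \<xi> q \<sigma> by (intro rlb h C) auto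
    ultimately have "\<bar>(\<Sum>i=1..n. \<alpha> i * rl_integral (q - \<nu>) h (\<eta> i)) - rl_integral (q - \<sigma>) h \<xi>\<bar> \<le> W * C"
      by linarith
    then have "Gamma (2 - \<sigma>) * Gamma (2 - \<nu>) / \<bar>\<Delta>\<^sub>1\<bar> *
        \<bar>(\<Sum>i=1..n. \<alpha> i * rl_integral (q - \<nu>) h (\<eta> i)) - rl_integral (q - \<sigma>) h \<xi>\<bar> \<le> B * C"
      unfolding B_def mult.assoc using G by (intro mult_left_mono) auto
    then show ?thesis using G by (simp add: b_def abs_mult)
  qed
  have ab: "\<bar>a h\<bar> \<le> (A + B * \<bar>\<Delta>\<^sub>3\<bar> / (2 * \<bar>\<Delta>\<^sub>2\<bar>)) * C"
    if h: "continuous_on {0..1} h" and C: "\<And>s. s \<in> {0..1} \<Longrightarrow> \<bar>h s\<bar> \<le> C" for h C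
  proof -
    let ?Z = "\<Sum>i=1..n. \<beta> i * rl_integral (q + 1) h (\<eta> i) + \<gamma> i * rl_integral q h (\<eta> i)"
    have Zi: "\<bar>\<beta> i * rl_integral (q + 1) h (\<eta> i) + \<gamma> i * rl_integral q h (\<eta> i)\<bar>
        \<le> \<eta> i powr q * (\<eta> i * \<bar>\<beta> i\<bar> + (q + 1) * \<bar>\<gamma> i\<bar>) * (C / Gamma (q + 2))" if "i \<in> {1..n}" for i
    proof -
      have "\<bar>\<beta> i * rl_integral (q + 1) h (\<eta> i)\<bar> \<le> \<bar>\<beta> i\<bar> * (C * (\<eta> i powr (q + 1) / Gamma (q + 1 + 1)))"
        unfolding abs_mult using \<eta>[OF that] q by (intro mult_left_mono rlb h C) auto
      moreover have "\<bar>\<gamma> i * rl_integral q h (\<eta> i)\<bar> \<le> \<bar>\<gamma> i\<bar> * (C * (\<eta> i powr q / Gamma (q + 1)))"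
        unfolding abs_mult using \<eta>[OF that] q by (intro mult_left_mono rlb h C) auto
      moreover have "1 / Gamma (q + 1) = (q + 1) / Gamma (q + 2)"
        using G q by (simp add: Gq2)
      moreover have "\<eta> i powr (q + 1) = \<eta> i powr q * \<eta> i"
        using \<eta>[OF that] by (simp add: powr_add)
      ultimately show ?thesis
        by (intro order_trans[OF abs_triangle_ineq]) (simp add: algebra_simps add_divide_distrib divide_inverse)
    qed
    have "\<bar>?Z\<bar> \<le> (\<Sum>i=1..n. \<eta> i powr q * (\<eta> i * \<bar>\<beta> i\<bar> + (q + 1) * \<bar>\<gamma> i\<bar>) * (C / Gamma (q + 2)))"
      by (intro order_trans[OF sum_abs] sum_mono Zi)
    then have Z: "\<bar>?Z\<bar> \<le> (\<Sum>i=1..n. \<eta> i powr q * (\<eta> i * \<bar>\<beta> i\<bar> + (q + 1) * \<bar>\<gamma> i\<bar>)) * (C / Gamma (q + 2))"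
      by (simp only: sum_distrib_right)
    have "\<bar>rl_integral q h 1\<bar> \<le> C * (1 powr q / Gamma (q + 1))"
      using q by (intro rlb h C) auto
    then have R: "\<bar>rl_integral q h 1\<bar> \<le> (1 + q) * (C / Gamma (q + 2))"
      using G q by (simp add: Gq2 add.commute)
    have D: "\<bar>b h * \<Delta>\<^sub>3 / 2\<bar> \<le> B * C * \<bar>\<Delta>\<^sub>3\<bar> / 2"
      using bb[OF h C] by (simp add: abs_mult mult_right_mono)
    have "\<bar>?Z - rl_integral q h 1 + b h * \<Delta>\<^sub>3 / 2\<bar> \<le> \<bar>?Z\<bar> + \<bar>rl_integral q h 1\<bar> + \<bar>b h * \<Delta>\<^sub>3 / 2\<bar>"
      by linarith
    also have "\<dots> \<le> (1 + q + (\<Sum>i=1..n. \<eta> i powr q * (\<eta> i * \<bar>\<beta> i\<bar> + (q + 1) * \<bar>\<gamma> i\<bar>))) * (C / Gamma (q + 2))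
        + B * C * \<bar>\<Delta>\<^sub>3\<bar> / 2"
      using Z R D unfolding distrib_right[of _ _ "C / Gamma (q + 2)"] by linarith
    also have "\<dots> = (A + B * \<bar>\<Delta>\<^sub>3\<bar> / (2 * \<bar>\<Delta>\<^sub>2\<bar>)) * C * \<bar>\<Delta>\<^sub>2\<bar>"
    proof -
      have "X * (C / g) + B * C * D / 2 = (1 / (w * g) * X + B * D / (2 * w)) * C * w"
        if "w \<noteq> 0" "g \<noteq> 0" for X g w D
        using that by (simp add: field_simps)
      moreover have "\<bar>\<Delta>\<^sub>2\<bar> \<noteq> 0" "Gamma (q + 2) \<noteq> 0" using \<open>\<Delta>\<^sub>2 \<noteq> 0\<close> G(4) by linarith+
      ultimately show ?thesis unfolding A_def by blast
    qed
    finally show ?thesis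
      using \<open>\<Delta>\<^sub>2 \<noteq> 0\<close> by (simp add: a_def abs_divide pos_divide_le_eq)
  qed

  \<comment> \<open>Existence of a fixed point\<close>
  have "\<exists>x. continuous_on {0..1} x \<and> (\<forall>t\<in>{0..1}. x t = S (\<lambda>s. f s (x s)) t)"
  proof (rule nonlinear_integral_equation_solvable[where S = S and f = f and M = M and m = m and \<Theta> = \<Theta> and L = "1 / Gamma q + B"])
    show "continuous_on ({0..1} \<times> UNIV) (\<lambda>(t, x). f t x)" by (rule assms(18))
    show "0 \<le> M" using \<open>0 < M\<close> by simp
    \<comment> \<open>A nonpositive denominator, including 0 since division by 0 gives 0, would make
      the quotient nonpositive and contradict that it exceeds 1.\<close>
    have "0 < \<Theta> * \<psi> M * (SUP t\<in>{0..1}. \<bar>p t\<bar>)"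
      using assms(25) \<open>0 < M\<close> by (smt (verit) divide_nonneg_nonpos)
    then show "\<Theta> * m \<le> M"
      using assms(25) by (simp add: m_def less_divide_eq mult_ac)
  next
    fix t x :: real assume t: "t \<in> {0..1}" and "\<bar>x\<bar> \<le> M"
    \<comment> \<open>The supremum is an upper bound only after boundedness is known; it follows
      from continuity of \<open>p\<close> on a compact interval.\<close>
    have "bdd_above ((\<lambda>t. \<bar>p t\<bar>) ` {0..1})"
      by (intro bounded_imp_bdd_above compact_imp_bounded compact_continuous_image continuous_intros assms(19)) auto
    then have "\<bar>p t\<bar> \<le> (SUP t\<in>{0..1}. \<bar>p t\<bar>)" using t by (intro cSUP_upper)
    moreover have "\<psi> \<bar>x\<bar> \<le> \<psi> M"
      using \<open>\<bar>x\<bar> \<le> M\<close> \<open>0 < M\<close> by (intro mono_onD[OF assms(21)]) auto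
    ultimately have "p t * \<psi> \<bar>x\<bar> \<le> m"
      unfolding m_def using assms(20)[OF t] assms(22)[of "\<bar>x\<bar>"] by (intro mult_mono) auto
    then show "\<bar>f t x\<bar> \<le> m" using assms(23)[OF t, of x] by linarith
  next
    fix h k :: "real \<Rightarrow> real" and t :: real
    assume h: "continuous_on {0..1} h" and k: "continuous_on {0..1} k" and t: "t \<in> {0..1}"
    have d: "rl_integral \<mu> (\<lambda>s. h s - k s) t = rl_integral \<mu> h t - rl_integral \<mu> k t"
      if "0 < \<mu>" "t \<in> {0..1}" for \<mu> t
      using that by (intro rl_integral_diff continuous_on_subset[OF h] continuous_on_subset[OF k]) auto
    have d\<eta>: "rl_integral \<mu> (\<lambda>s. h s - k s) (\<eta> i) = rl_integral \<mu> h (\<eta> i) - rl_integral \<mu> k (\<eta> i)"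
      if "0 < \<mu>" "i \<in> {1..n}" for \<mu> i
      using \<eta>[OF that(2)] that(1) by (intro d) auto
    have "(\<Sum>i=1..n. \<alpha> i * rl_integral (q - \<nu>) (\<lambda>s. h s - k s) (\<eta> i))
      = (\<Sum>i=1..n. \<alpha> i * rl_integral (q - \<nu>) h (\<eta> i)) - (\<Sum>i=1..n. \<alpha> i * rl_integral (q - \<nu>) k (\<eta> i))"
      unfolding sum_subtractf[symmetric] using q \<nu> by (intro sum.cong) (auto simp: d\<eta> algebra_simps)
    moreover have "rl_integral (q - \<sigma>) (\<lambda>s. h s - k s) \<xi> = rl_integral (q - \<sigma>) h \<xi> - rl_integral (q - \<sigma>) k \<xi>"
      using q \<sigma> \<xi> by (intro d) auto
    ultimately have b: "b (\<lambda>s. h s - k s) = b h - b k"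
      unfolding b_def right_diff_distrib[symmetric] by simp
    have "(\<Sum>i=1..n. \<beta> i * rl_integral (q + 1) (\<lambda>s. h s - k s) (\<eta> i) + \<gamma> i * rl_integral q (\<lambda>s. h s - k s) (\<eta> i))
      = (\<Sum>i=1..n. \<beta> i * rl_integral (q + 1) h (\<eta> i) + \<gamma> i * rl_integral q h (\<eta> i))
      - (\<Sum>i=1..n. \<beta> i * rl_integral (q + 1) k (\<eta> i) + \<gamma> i * rl_integral q k (\<eta> i))"
      unfolding sum_subtractf[symmetric] using q by (intro sum.cong) (auto simp: d\<eta> algebra_simps)
    note Z = this
    have "rl_integral q (\<lambda>s. h s - k s) 1 = rl_integral q h 1 - rl_integral q k 1"
      using q by (intro d) auto
    then have a: "a (\<lambda>s. h s - k s) = a h - a k"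
      unfolding a_def Z b diff_divide_distrib[symmetric]
      by (intro arg_cong2[where f = "(/)"] refl) (simp add: left_diff_distrib diff_divide_distrib)
    show "S (\<lambda>s. h s - k s) t = S h t - S k t"
      unfolding S_def using q t by (simp add: a b d algebra_simps)
  next
    fix h :: "real \<Rightarrow> real" and C t :: real
    assume h: "continuous_on {0..1} h" and C: "\<And>s. s \<in> {0..1} \<Longrightarrow> \<bar>h s\<bar> \<le> C" and t: "t \<in> {0..1}"
    have "0 \<le> C" using C[of 0] by simp
    have "\<bar>rl_integral q h t\<bar> \<le> C * (t powr q / Gamma (q + 1))"
      using q t by (intro rlb h C) auto
    also have "\<dots> \<le> C * (1 / Gamma (q + 1))"
      using q t G \<open>0 \<le> C\<close> by (intro mult_left_mono divide_right_mono powr_le1) auto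
    finally have 1: "\<bar>rl_integral q h t\<bar> \<le> 1 / Gamma (q + 1) * C" by simp
    have "\<bar>b h * t\<bar> \<le> \<bar>b h\<bar> * 1" unfolding abs_mult using t by (intro mult_left_mono) auto
    then have 2: "\<bar>b h * t\<bar> \<le> B * C" using bb[OF h C] by linarith
    show "\<bar>S h t\<bar> \<le> \<Theta> * C"
      unfolding S_def \<Theta> distrib_right[of _ _ C] using 1 2 ab[OF h C, unfolded distrib_right[of _ _ C]] by linarith
    fix s :: real assume s: "s \<in> {0..1}"
    \<comment> \<open>The constant \<open>a h\<close> cancels, so the Lipschitz constant combines
      that of the integral of order \<open>q\<close> with the bound for the slope
      \<open>b h\<close>.\<close>
    have "S h t - S h s = (rl_integral q h t - rl_integral q h s) + b h * (t - s)"
      by (simp add: S_def algebra_simps)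
    then have "\<bar>S h t - S h s\<bar> \<le> \<bar>rl_integral q h t - rl_integral q h s\<bar> + \<bar>b h * (t - s)\<bar>"
      by (metis abs_triangle_ineq)
    also have "\<dots> \<le> C / Gamma q * \<bar>t - s\<bar> + B * C * \<bar>t - s\<bar>"
      unfolding abs_mult[of "b h"]
      by (intro add_mono mult_right_mono bb rl_integral_lipschitz q h C s t) auto
    finally show "\<bar>S h t - S h s\<bar> \<le> (1 / Gamma q + B) * C * \<bar>t - s\<bar>"
      by (simp add: algebra_simps)
  qed
  then obtain x where x: "continuous_on {0..1} x" and xS: "\<And>t. t \<in> {0..1} \<Longrightarrow> x t = S (\<lambda>s. f s (x s)) t"
    by blast

  \<comment> \<open>The fixed point solves the boundary value problem\<close>
  define h where "h = (\<lambda>s. f s (x s))"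
  have "continuous_on {0..1} (\<lambda>s. (\<lambda>(t, x). f t x) (s, x s))"
    by (rule continuous_on_compose2[OF assms(18)]) (auto intro!: continuous_intros x)
  then have h: "continuous_on {0..1} h" by (simp add: h_def)
  have xr: "x t = rl_integral q h t + a h + b h * t" if "t \<in> {0..1}" for t
    using xS[OF that] by (simp add: S_def h_def)
  note caputo_x = rl_affine_caputo_le_1[OF q h xr] and integral_x = rl_affine_integral[OF q h xr]

  show ?thesis
  proof (intro exI[of _ x] conjI ballI)
    show "C1_01 x" "caputo_differentiable q x"
      by (rule rl_affine_C1_01[OF q h xr] rl_affine_caputo_differentiable[OF q h xr]; assumption)+
    show "caputo q x t = f t (x t)" if "t \<in> {0..1}" for t
      using rl_affine_caputo[OF q h xr that] by (simp add: h_def)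
  next
    let ?Y = "\<Sum>i=1..n. \<alpha> i * rl_integral (q - \<nu>) h (\<eta> i)"
    let ?E = "\<Sum>i=1..n. \<alpha> i * \<eta> i powr (1 - \<nu>)"
    have "(\<Sum>i=1..n. \<alpha> i * caputo \<nu> x (\<eta> i))
        = (\<Sum>i=1..n. \<alpha> i * (rl_integral (q - \<nu>) h (\<eta> i) + b h * (\<eta> i powr (1 - \<nu>) / Gamma (2 - \<nu>))))"
      by (intro sum.cong refl arg_cong2[where f = "(*)"] caputo_x \<nu> \<eta>)
    also have "\<dots> = ?Y + b h * ?E / Gamma (2 - \<nu>)"
      by (simp add: distrib_left sum.distrib sum_distrib_left sum_divide_distrib mult_ac)
    finally have 1: "(\<Sum>i=1..n. \<alpha> i * caputo \<nu> x (\<eta> i)) = ?Y + b h * ?E / Gamma (2 - \<nu>)" .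
    have 2: "caputo \<sigma> x \<xi> = rl_integral (q - \<sigma>) h \<xi> + b h * \<xi> powr (1 - \<sigma>) / Gamma (2 - \<sigma>)"
      using caputo_x[OF _ \<sigma> \<xi>] by simp
    \<comment> \<open>This is the first boundary condition with denominators cleared and the terms
      in \<open>b h\<close> collected on the left.\<close>
    have "b h * \<Delta>\<^sub>1 = Gamma (2 - \<sigma>) * Gamma (2 - \<nu>) * (?Y - rl_integral (q - \<sigma>) h \<xi>)"
      using \<open>\<Delta>\<^sub>1 \<noteq> 0\<close> by (simp add: b_def)
    then have "b h * (\<xi> powr (1 - \<sigma>) * Gamma (2 - \<nu>) - Gamma (2 - \<sigma>) * ?E)
        = Gamma (2 - \<sigma>) * Gamma (2 - \<nu>) * (?Y - rl_integral (q - \<sigma>) h \<xi>)"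
      unfolding assms(12) .
    then show "caputo \<sigma> x \<xi> = (\<Sum>i=1..n. \<alpha> i * caputo \<nu> x (\<eta> i))"
      unfolding 1 2 using G(1,2) by (simp add: field_simps)
  next
    let ?Z = "\<Sum>i=1..n. \<beta> i * rl_integral (q + 1) h (\<eta> i) + \<gamma> i * rl_integral q h (\<eta> i)"
    let ?E1 = "\<Sum>i=1..n. \<beta> i * \<eta> i + \<gamma> i" and ?E2 = "\<Sum>i=1..n. \<eta> i * (\<beta> i * \<eta> i + 2 * \<gamma> i)"
    \<comment> \<open>The right-hand side is sorted by \<open>a h\<close> and
      \<open>b h / 2\<close>, whose coefficients become \<open>1 - \<Delta>\<^sub>2\<close> and
      \<open>\<Delta>\<^sub>3 + 2\<close>; the defining equation of \<open>a h\<close> then gives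
      \<open>x 1\<close>.\<close>
    have "(\<Sum>i=1..n. \<beta> i * integral {0..\<eta> i} x) + (\<Sum>i=1..n. \<gamma> i * x (\<eta> i))
        = (\<Sum>i=1..n. (\<beta> i * rl_integral (q + 1) h (\<eta> i) + \<gamma> i * rl_integral q h (\<eta> i))
            + a h * (\<beta> i * \<eta> i + \<gamma> i) + b h / 2 * (\<eta> i * (\<beta> i * \<eta> i + 2 * \<gamma> i)))"
      unfolding sum.distrib[symmetric]
    proof (intro sum.cong refl)
      fix i assume "i \<in> {1..n}"
      then have \<eta>i: "\<eta> i \<in> {0..1}" using \<eta> by force
      have "integral {0..\<eta> i} x = rl_integral (q + 1) h (\<eta> i) + a h * \<eta> i + b h * (\<eta> i)\<^sup>2 / 2"
        using \<eta>i by (intro integral_x)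
      with \<eta>i show "\<beta> i * integral {0..\<eta> i} x + \<gamma> i * x (\<eta> i)
          = \<beta> i * rl_integral (q + 1) h (\<eta> i) + \<gamma> i * rl_integral q h (\<eta> i)
            + a h * (\<beta> i * \<eta> i + \<gamma> i) + b h / 2 * (\<eta> i * (\<beta> i * \<eta> i + 2 * \<gamma> i))"
        by (simp add: xr power2_eq_square algebra_simps)
    qed
    also have "\<dots> = ?Z + a h * ?E1 + b h / 2 * ?E2"
      by (simp only: sum_distrib_left flip: sum.distrib)
    also have "\<dots> = ?Z + a h * (1 - \<Delta>\<^sub>2) + b h / 2 * (\<Delta>\<^sub>3 + 2)"
      using assms(13,14) by simp
    finally have 1: "(\<Sum>i=1..n. \<beta> i * integral {0..\<eta> i} x) + (\<Sum>i=1..n. \<gamma> i * x (\<eta> i))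
        = ?Z + a h * (1 - \<Delta>\<^sub>2) + b h / 2 * (\<Delta>\<^sub>3 + 2)" .
    have "a h * \<Delta>\<^sub>2 = ?Z - rl_integral q h 1 + b h * \<Delta>\<^sub>3 / 2"
      using \<open>\<Delta>\<^sub>2 \<noteq> 0\<close> by (simp add: a_def)
    then show "x 1 = (\<Sum>i=1..n. \<beta> i * integral {0..\<eta> i} x) + (\<Sum>i=1..n. \<gamma> i * x (\<eta> i))"
      unfolding 1 by (simp add: xr algebra_simps)
  qed
qed

end
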